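(* Let $q\in[1,2]$ and $r\in[2,\infty]$ with $\frac q2+\frac1r=1$. Let $\mathbb Q$ be a probability measure absolutely continuous with respect to $\mathbb P$ with $\mathrm d\mathbb Q/\mathrm d\mathbb P\in L_r(\mathbb P)$. Assume that for some $\alpha\in(0,2]$, $$\sup_{r'\in(0,1)}\Big\|(\omega,t)\mapsto (r')^\alpha\int_{r'<|z|\le1}\nu_t(\omega,\mathrm dz)\Big\|_{L_\infty(\Omega\times[0,T],\mathbb P\otimes\lambda)}<\infty.$$ Then for any $\theta\in(0,1]$ and any sequence $(\varepsilon_n)_{n\ge1}\subset(0,\infty)$ with $\inf_{n\ge1}\sqrt[\alpha]{n}\,\varepsilon_n>0$, there exists a constant $c\ge1$ such that for any $n\ge1$ and any $\tau_n\in\mathcal T_{\det}$ with $\#\tau_n=n+1$ one has $$\frac nc\le\Big\|\#\,\tau_n\sqcup\rho\big(\varepsilon_n,\tfrac{1-\theta}2\big)\Big\|_{L_q(\mathbb Q)}\le c\,n.$$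
   Context: **General setting.** Fix $T\in(0,\infty)$ and a complete probability space $(\Omega,\mathcal F,\mathbb P)$ with a right-continuous filtration $(\mathcal F_t)_{t\in[0,T]}$ such that $\mathcal F_0$ is generated by the $\mathbb P$-null sets only. $\lambda$ is Lebesgue measure, $\mathbb R_0=\mathbb R\setminus\{0\}$, $\inf\emptyset:=\infty$. $\mathrm{CL}([0,T])$ is the set of càdlàg adapted processes on $[0,T]$; $X_{0-}:=X_0$, $\Delta X:=X-X_-$. *Process $Z$.* $Z\in\mathrm{CL}([0,T])$ is a square integrable semimartingale with $$Z_t=Z_0+Z^{c}_t+\int_0^t\!\int_{\mathbb R_0}z\,(N_Z-\pi_Z)(\mathrm du,\mathrm dz)+\int_0^t b^Z_u\,\mathrm du,$$ where $Z_0\in\mathbb R$, $b^Z$ is progressively measurable, $Z^c$ is a continuous square integrable martingale with $Z^c_0=0$, $N_Z$ is the jump random measure of $Z$ and $\pi_Z$ its predictable compensator, such that: $\pi_Z(\omega,\mathrm dt,\mathrm dz)=\nu_t(\omega,\mathrm dz)\,\mathrm dt$ for all $\omega$, where $\nu_t(\omega,\cdot)$ is a transition kernel of Lévy measures ($\nu_t(\omega,\{0\})=0$, $\int(z^2\wedge1)\,\nu_t(\omega,\mathrm dz)<\infty$); $\mathrm d\langle Z^c\rangle_t=|a^Z_t|^2\mathrm dt$ with $a^Z$ progressively measurable and $a^Z\in L_\infty(\Omega\times[0,T],\mathbb P\otimes\lambda)$; $\int_0^T|b^Z_u|^2\mathrm du\in L_\infty(\mathbb P)$; and $(\omega,t)\mapsto\int_{\mathbb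 R}z^2\nu_t(\omega,\mathrm dz)$ lies in $L_\infty(\Omega\times[0,T],\mathbb P\otimes\lambda)$. *Process $S$.* $S\in\mathrm{CL}([0,T])$ is the strong solution of $\mathrm dS_t=\sigma(S_{t-})\,\mathrm dZ_t$, $S_0\in\mathcal R_S$, where $\mathcal R_S\subseteq\mathbb R$ is open, $\sigma:\mathcal R_S\to(0,\infty)$ is Lipschitz, and $S_t(\omega),S_{t-}(\omega)\in\mathcal R_S$ for all $(\omega,t)$. **Time-nets.** $\mathcal T_{\det}$ is the set of deterministic nets $\tau=(t_i)_{i=0}^n$ with $0=t_0<t_1<\dots<t_n=T$, $n\ge1$. For $\varepsilon>0$ and $\kappa\ge0$ let $\rho_0(\varepsilon,\kappa):=0$ and $\rho_i(\varepsilon,\kappa):=\inf\{t\in(\rho_{i-1}(\varepsilon,\kappa),T]:|\Delta S_t|>\sigma(S_{t-})\,\varepsilon(T-t)^\kappa\}\wedge T$ for $i\ge1$; $\rho(\varepsilon,\kappa):=(\rho_i(\varepsilon,\kappa))_{i\ge0}$. $\tau\sqcup\rho(\varepsilon,\kappa)$ denotes the random collection of time-knots in $[0,T]$ obtained by combining $\tau$ with $\rho(\varepsilon,\kappa)$ and re-ordering (so $\#\,\tau\sqcup\rho(\varepsilon,\kappa)$ is the number of distinct knots). *)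

theory Defs
  imports "HOL-Probability.Probability" "HOL-Probability.Stopping_Time"
    "HOL-Probability.Essential_Supremum"
begin

section \<open>\<open>L\<^sub>p\<close>-norms of \<open>[0,\<infinity>]\<close>-valued functions\<close>

text \<open>The power is meant for exponents \<open>p > 0\<close>.\<close>

definition ennpowr :: "ennreal \<Rightarrow> real \<Rightarrow> ennreal" where
  "ennpowr x p = (if x = \<infinity> then \<infinity> else ennreal (enn2real x powr p))"

text \<open>As for \<^const>\<open>esssup\<close>, non-measurable functions get norm \<open>\<infinity>\<close>, so a finite norm
  entails measurability.\<close>

definition Lp_norm :: "'a measure \<Rightarrow> ennreal \<Rightarrow> ('a \<Rightarrow> ennreal) \<Rightarrow> ennreal" where
  "Lp_norm M p f =
     (if f \<notin> borel_measurable M then \<infinity>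
      else if p = \<infinity> then esssup M f
      else ennpowr (\<integral>\<^sup>+ x. ennpowr (f x) (enn2real p) \<partial>M) (1 / enn2real p))"


section \<open>Processes on \<open>[0,T]\<close>\<close>

text \<open>A process is a function of time and sample point, of which only the values at times in
  \<open>{0..T}\<close> matter. A filtration over \<open>[0,T]\<close> is encoded as one over the type \<^typ>\<open>real\<close>
  (extend it constantly to the left of \<open>0\<close> and to the right of \<open>T\<close>).\<close>

type_synonym 'a process = "real \<Rightarrow> 'a \<Rightarrow> real"

definition time_space :: "real \<Rightarrow> real measure" where
  "time_space T = restrict_space lborel {0..T}"

definition adapted :: "(real \<Rightarrow> 'a measure) \<Rightarrow> real \<Rightarrow> 'a process \<Rightarrow> bool" where
  "adapted F T X \<longleftrightarrow> (\<forall>t\<in>{0..T}. X t \<in> borel_measurable (F t))"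

definition progressive :: "(real \<Rightarrow> 'a measure) \<Rightarrow> real \<Rightarrow> 'a process \<Rightarrow> bool" where
  "progressive F T X \<longleftrightarrow>
     (\<forall>t\<in>{0..T}. (\<lambda>(\<omega>, s). X s \<omega>) \<in> borel_measurable (F t \<Otimes>\<^sub>M restrict_space borel {0..t}))"

definition cadlag_path :: "real \<Rightarrow> (real \<Rightarrow> real) \<Rightarrow> bool" where
  "cadlag_path T f \<longleftrightarrow>
     (\<forall>t\<in>{0..<T}. (f \<longlongrightarrow> f t) (at_right t)) \<and>
     (\<forall>t\<in>{0<..T}. \<exists>l. (f \<longlongrightarrow> l) (at_left t))"

definition caglad_path :: "real \<Rightarrow> (real \<Rightarrow> real) \<Rightarrow> bool" where
  "caglad_path T f \<longleftrightarrow>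
     (\<forall>t\<in>{0<..T}. (f \<longlongrightarrow> f t) (at_left t)) \<and>
     (\<forall>t\<in>{0..<T}. \<exists>l. (f \<longlongrightarrow> l) (at_right t))"

definition CL :: "'a measure \<Rightarrow> (real \<Rightarrow> 'a measure) \<Rightarrow> real \<Rightarrow> 'a process set" where
  "CL M F T = {X. adapted F T X \<and> (\<forall>\<omega>\<in>space M. cadlag_path T (\<lambda>t. X t \<omega>))}"

definition continuous_paths :: "'a measure \<Rightarrow> real \<Rightarrow> 'a process \<Rightarrow> bool" where
  "continuous_paths M T X \<longleftrightarrow> (\<forall>\<omega>\<in>space M. continuous_on {0..T} (\<lambda>t. X t \<omega>))"

definition left_limit :: "'a process \<Rightarrow> 'a process" where
  "left_limit X t \<omega> = (if t = 0 then X 0 \<omega> else Lim (at_left t) (\<lambda>s. X s \<omega>))"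

definition jump :: "'a process \<Rightarrow> 'a process" where
  "jump X t \<omega> = X t \<omega> - left_limit X t \<omega>"

text \<open>The predictable \<open>\<sigma>\<close>-algebra on \<open>\<Omega> \<times> [0,T]\<close>.\<close>

definition predictable_sigma :: "'a measure \<Rightarrow> (real \<Rightarrow> 'a measure) \<Rightarrow> real \<Rightarrow> ('a \<times> real) measure"
  where
  "predictable_sigma M F T = sigma (space M \<times> {0..T})
     ({A \<times> {0} | A. A \<in> sets (F 0)} \<union>
      {A \<times> {s<..t} | A s t. 0 \<le> s \<and> s < t \<and> t \<le> T \<and> A \<in> sets (F s)})"

definition predictable :: "'a measure \<Rightarrow> (real \<Rightarrow> 'a measure) \<Rightarrow> real \<Rightarrow> 'a process \<Rightarrow> bool" where
  "predictable M F T X \<longleftrightarrow> (\<lambda>(\<omega>, t). X t \<omega>) \<in> borel_measurable (predictable_sigma M F T)"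


section \<open>Martingales and semimartingales\<close>

definition is_martingale :: "'a measure \<Rightarrow> (real \<Rightarrow> 'a measure) \<Rightarrow> real \<Rightarrow> 'a process \<Rightarrow> bool" where
  "is_martingale M F T X \<longleftrightarrow>
     X \<in> CL M F T \<and>
     (\<forall>t\<in>{0..T}. integrable M (X t)) \<and>
     (\<forall>s\<in>{0..T}. \<forall>t\<in>{s..T}. AE \<omega> in M. real_cond_exp M (F s) (X t) \<omega> = X s \<omega>)"

definition square_integrable :: "'a measure \<Rightarrow> real \<Rightarrow> 'a process \<Rightarrow> bool" where
  "square_integrable M T X \<longleftrightarrow> (\<forall>t\<in>{0..T}. integrable M (\<lambda>\<omega>. (X t \<omega>)\<^sup>2))"

text \<open>On the compact horizon a localizing sequence is one that is eventually equal to \<open>T\<close>.\<close>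

definition local_martingale :: "'a measure \<Rightarrow> (real \<Rightarrow> 'a measure) \<Rightarrow> real \<Rightarrow> 'a process \<Rightarrow> bool"
  where
  "local_martingale M F T X \<longleftrightarrow>
     X \<in> CL M F T \<and>
     (\<exists>\<tau> :: nat \<Rightarrow> 'a \<Rightarrow> real.
        (\<forall>k. stopping_time F (\<tau> k)) \<and>
        (\<forall>k. \<forall>\<omega>\<in>space M. 0 \<le> \<tau> k \<omega> \<and> \<tau> k \<omega> \<le> \<tau> (Suc k) \<omega> \<and> \<tau> k \<omega> \<le> T) \<and>
        (AE \<omega> in M. \<exists>k. \<tau> k \<omega> = T) \<and>
        (\<forall>k. is_martingale M F T (\<lambda>t \<omega>. X (min t (\<tau> k \<omega>)) \<omega>)))"

definition purely_discontinuous :: "'a measure \<Rightarrow> (real \<Rightarrow> 'a measure) \<Rightarrow> real \<Rightarrow> 'a process \<Rightarrow> bool"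
  where
  "purely_discontinuous M F T X \<longleftrightarrow>
     local_martingale M F T X \<and> (AE \<omega> in M. X 0 \<omega> = 0) \<and>
     (\<forall>Y. local_martingale M F T Y \<and> continuous_paths M T Y \<longrightarrow>
        local_martingale M F T (\<lambda>t \<omega>. X t \<omega> * Y t \<omega>))"

definition finite_variation_path :: "real \<Rightarrow> (real \<Rightarrow> real) \<Rightarrow> bool" where
  "finite_variation_path T f \<longleftrightarrow>
     (\<exists>C. \<forall>n. \<forall>p :: nat \<Rightarrow> real. mono p \<and> range p \<subseteq> {0..T} \<longrightarrow>
        (\<Sum>i<n. \<bar>f (p (Suc i)) - f (p i)\<bar>) \<le> C)"

definition semimartingale :: "'a measure \<Rightarrow> (real \<Rightarrow> 'a measure) \<Rightarrow> real \<Rightarrow> 'a process \<Rightarrow> bool"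
  where
  "semimartingale M F T X \<longleftrightarrow>
     X \<in> CL M F T \<and>
     (\<exists>L A. local_martingale M F T L \<and> A \<in> CL M F T \<and>
        (\<forall>\<omega>\<in>space M. finite_variation_path T (\<lambda>t. A t \<omega>)) \<and>
        (AE \<omega> in M. \<forall>t\<in>{0..T}. X t \<omega> = X 0 \<omega> + L t \<omega> + A t \<omega>))"

text \<open>\<open>A\<close> is a version of the predictable quadratic variation (angle bracket) of \<open>X\<close>.\<close>

definition angle_bracket ::
  "'a measure \<Rightarrow> (real \<Rightarrow> 'a measure) \<Rightarrow> real \<Rightarrow> 'a process \<Rightarrow> 'a process \<Rightarrow> bool" where
  "angle_bracket M F T X A \<longleftrightarrow>
     A \<in> CL M F T \<and> predictable M F T A \<and>
     (\<forall>\<omega>\<in>space M. A 0 \<omega> = 0 \<and> mono_on {0..T} (\<lambda>t. A t \<omega>)) \<and>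
     local_martingale M F T (\<lambda>t \<omega>. (X t \<omega>)\<^sup>2 - A t \<omega>)"


section \<open>Random measures\<close>

text \<open>Random measures live on \<open>[0,T] \<times> \<real>\<close>; they charge neither time \<open>0\<close> nor, in the cases used
  below, the mark \<open>0\<close>.\<close>

definition time_mark_space :: "real \<Rightarrow> (real \<times> real) measure" where
  "time_mark_space T = restrict_space borel {0..T} \<Otimes>\<^sub>M borel"

definition random_measure ::
  "'a measure \<Rightarrow> real \<Rightarrow> ('a \<Rightarrow> (real \<times> real) measure) \<Rightarrow> bool" where
  "random_measure M T \<mu> \<longleftrightarrow>
     (\<forall>\<omega>\<in>space M. sets (\<mu> \<omega>) = sets (time_mark_space T) \<and> emeasure (\<mu> \<omega>) ({0} \<times> UNIV) = 0) \<and>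
     (\<forall>B\<in>sets (time_mark_space T). (\<lambda>\<omega>. emeasure (\<mu> \<omega>) B) \<in> borel_measurable M)"

definition jump_measure :: "real \<Rightarrow> 'a process \<Rightarrow> 'a \<Rightarrow> (real \<times> real) measure" where
  "jump_measure T X \<omega> =
     distr (count_space {s\<in>{0<..T}. jump X s \<omega> \<noteq> 0}) (time_mark_space T) (\<lambda>s. (s, jump X s \<omega>))"

definition predictable_fun ::
  "'a measure \<Rightarrow> (real \<Rightarrow> 'a measure) \<Rightarrow> real \<Rightarrow> (('a \<times> real) \<times> real \<Rightarrow> ennreal) set" where
  "predictable_fun M F T = borel_measurable (predictable_sigma M F T \<Otimes>\<^sub>M borel)"

definition predictable_random_measure ::
  "'a measure \<Rightarrow> (real \<Rightarrow> 'a measure) \<Rightarrow> real \<Rightarrow> ('a \<Rightarrow> (real \<times> real) measure) \<Rightarrow> bool" where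
  "predictable_random_measure M F T \<mu> \<longleftrightarrow>
     random_measure M T \<mu> \<and>
     (\<forall>W\<in>predictable_fun M F T.
        (\<lambda>(\<omega>, t). \<integral>\<^sup>+ (s, z). W ((\<omega>, s), z) * indicator {0..t} s \<partial>\<mu> \<omega>)
          \<in> borel_measurable (predictable_sigma M F T))"

definition is_compensator ::
  "'a measure \<Rightarrow> (real \<Rightarrow> 'a measure) \<Rightarrow> real \<Rightarrow>
     ('a \<Rightarrow> (real \<times> real) measure) \<Rightarrow> ('a \<Rightarrow> (real \<times> real) measure) \<Rightarrow> bool" where
  "is_compensator M F T \<mu> \<pi> \<longleftrightarrow>
     predictable_random_measure M F T \<pi> \<and>
     (\<forall>W\<in>predictable_fun M F T.
        (\<integral>\<^sup>+ \<omega>. (\<integral>\<^sup>+ (s, z). W ((\<omega>, s), z) \<partial>\<mu> \<omega>) \<partial>M) =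
        (\<integral>\<^sup>+ \<omega>. (\<integral>\<^sup>+ (s, z). W ((\<omega>, s), z) \<partial>\<pi> \<omega>) \<partial>M))"

text \<open>\<open>Y\<close> is a version of the stochastic integral \<open>\<integral>\<^sub>0 \<integral> W(u,z) (\<mu> - \<pi>)(du,dz)\<close> in the sense of
  Jacod and Shiryaev (Limit Theorems for Stochastic Processes, II.1.27): the purely discontinuous
  local martingale whose jump at \<open>t\<close> is \<open>\<integral> W(t,z) \<mu>({t},dz) - \<integral> W(t,z) \<pi>({t},dz)\<close>.\<close>

definition compensated_integral ::
  "'a measure \<Rightarrow> (real \<Rightarrow> 'a measure) \<Rightarrow> real \<Rightarrow>
     ('a \<Rightarrow> (real \<times> real) measure) \<Rightarrow> ('a \<Rightarrow> (real \<times> real) measure) \<Rightarrow>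
     ('a \<Rightarrow> real \<times> real \<Rightarrow> real) \<Rightarrow> 'a process \<Rightarrow> bool" where
  "compensated_integral M F T \<mu> \<pi> W Y \<longleftrightarrow>
     purely_discontinuous M F T Y \<and>
     (AE \<omega> in M. \<forall>t\<in>{0..T}.
        set_integrable (\<mu> \<omega>) ({t} \<times> UNIV) (W \<omega>) \<and>
        set_integrable (\<pi> \<omega>) ({t} \<times> UNIV) (W \<omega>) \<and>
        jump Y t \<omega> =
          set_lebesgue_integral (\<mu> \<omega>) ({t} \<times> UNIV) (W \<omega>)
          - set_lebesgue_integral (\<pi> \<omega>) ({t} \<times> UNIV) (W \<omega>))"

definition levy_measure :: "real measure \<Rightarrow> bool" where
  "levy_measure m \<longleftrightarrow>
     sets m = sets borel \<and> emeasure m {0} = 0 \<and> (\<integral>\<^sup>+ z. ennreal (min (z\<^sup>2) 1) \<partial>m) < \<infinity>"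

definition levy_kernel :: "'a measure \<Rightarrow> real \<Rightarrow> (real \<Rightarrow> 'a \<Rightarrow> real measure) \<Rightarrow> bool" where
  "levy_kernel M T \<nu> \<longleftrightarrow>
     (\<forall>t\<in>{0..T}. \<forall>\<omega>\<in>space M. levy_measure (\<nu> t \<omega>)) \<and>
     (\<forall>B\<in>sets borel.
        (\<lambda>(\<omega>, t). emeasure (\<nu> t \<omega>) B) \<in> borel_measurable (M \<Otimes>\<^sub>M time_space T))"


section \<open>The stochastic integral of caglad integrands\<close>

definition ucp_lim :: "'a measure \<Rightarrow> real \<Rightarrow> (nat \<Rightarrow> 'a process) \<Rightarrow> 'a process \<Rightarrow> bool" where
  "ucp_lim M T Xs X \<longleftrightarrow>
     (\<forall>e>0. (\<lambda>k. measure M {\<omega>\<in>space M. \<exists>t\<in>{0..T}. \<bar>Xs k t \<omega> - X t \<omega>\<bar> > e}) \<longlonglongrightarrow> 0)"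

text \<open>Data of the simple predictable process
  \<open>h\<^sub>0 1\<^bsub>{0}\<^esub> + \<Sum>\<^bsub>i<k\<^esub> h\<^sub>i 1\<^bsub>(\<tau>\<^sub>i, \<tau>\<^bsub>i+1\<^esub>]\<^esub>\<close>.\<close>

type_synonym 'a simple_data = "nat \<times> ('a \<Rightarrow> real) \<times> (nat \<Rightarrow> 'a \<Rightarrow> real) \<times> (nat \<Rightarrow> 'a \<Rightarrow> real)"

fun simple_data :: "'a measure \<Rightarrow> (real \<Rightarrow> 'a measure) \<Rightarrow> real \<Rightarrow> 'a simple_data \<Rightarrow> bool" where
  "simple_data M F T (k, h0, \<tau>, h) \<longleftrightarrow>
     h0 \<in> borel_measurable (F 0) \<and>
     (\<forall>i\<le>k. stopping_time F (\<tau> i) \<and> (\<forall>\<omega>\<in>space M. 0 \<le> \<tau> i \<omega> \<and> \<tau> i \<omega> \<le> T)) \<and>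
     (\<forall>i<k. (\<forall>\<omega>\<in>space M. \<tau> i \<omega> \<le> \<tau> (Suc i) \<omega>) \<and>
            h i \<in> borel_measurable (filtration.pre_sigma (space M) F (\<tau> i)))"

fun simple_process :: "'a simple_data \<Rightarrow> 'a process" where
  "simple_process (k, h0, \<tau>, h) t \<omega> =
     h0 \<omega> * indicator {0} t + (\<Sum>i<k. h i \<omega> * indicator {\<tau> i \<omega><..\<tau> (Suc i) \<omega>} t)"

text \<open>The integral is over \<open>(0,t]\<close>, hence there is no contribution of \<open>h\<^sub>0\<close>.\<close>

fun simple_integral :: "'a simple_data \<Rightarrow> 'a process \<Rightarrow> 'a process" where
  "simple_integral (k, h0, \<tau>, h) X t \<omega> =
     (\<Sum>i<k. h i \<omega> * (X (min (\<tau> (Suc i) \<omega>) t) \<omega> - X (min (\<tau> i \<omega>) t) \<omega>))"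

text \<open>\<open>I\<close> is a version of \<open>\<integral>\<^bsub>(0,\<sqdot>]\<^esub> H dX\<close> for an adapted caglad \<open>H\<close>. For a semimartingale \<open>X\<close> the
  elementary integral extends uniquely and continuously (in ucp) from simple predictable to adapted
  caglad integrands; the graph of this extension is the closure of the elementary graph.\<close>

definition stochastic_integral ::
  "'a measure \<Rightarrow> (real \<Rightarrow> 'a measure) \<Rightarrow> real \<Rightarrow> 'a process \<Rightarrow> 'a process \<Rightarrow> 'a process \<Rightarrow> bool"
  where
  "stochastic_integral M F T H X I \<longleftrightarrow>
     semimartingale M F T X \<and>
     adapted F T H \<and> (\<forall>\<omega>\<in>space M. caglad_path T (\<lambda>t. H t \<omega>)) \<and>
     I \<in> CL M F T \<and>
     (\<exists>D :: nat \<Rightarrow> 'a simple_data.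
        (\<forall>k. simple_data M F T (D k)) \<and>
        ucp_lim M T (\<lambda>k. simple_process (D k)) H \<and>
        ucp_lim M T (\<lambda>k. simple_integral (D k) X) I)"


section \<open>The standing assumptions\<close>

locale filtered_prob_space = prob_space M + complete_measure M + filtration "space M" F
  for M :: "'a measure" and F :: "real \<Rightarrow> 'a measure" +
  fixes T :: real
  assumes T_pos: "0 < T"
    and F_sub: "\<And>t. sets (F t) \<subseteq> sets M"
    and F_right_continuous: "\<And>t. 0 \<le> t \<Longrightarrow> t < T \<Longrightarrow> sets (F t) = (\<Inter>s\<in>{t<..T}. sets (F s))"
    and F_0: "sets (F 0) = sigma_sets (space M) (null_sets M)"

locale driving_process = filtered_prob_space M F T
  for M :: "'a measure" and F T +
  fixes Z :: "'a process" and z0 :: real and Zc :: "'a process"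
    and \<pi>Z :: "'a \<Rightarrow> (real \<times> real) measure" and \<nu> :: "real \<Rightarrow> 'a \<Rightarrow> real measure"
    and aZ bZ :: "'a process"
  assumes Z_semimartingale: "semimartingale M F T Z"
    and Z_square_integrable: "square_integrable M T Z"
    and Zc_martingale: "is_martingale M F T Zc"
    and Zc_square_integrable: "square_integrable M T Zc"
    and Zc_continuous: "continuous_paths M T Zc"
    and Zc_0: "AE \<omega> in M. Zc 0 \<omega> = 0"
    and bZ_progressive: "progressive F T bZ"
    and aZ_progressive: "progressive F T aZ"
    and \<pi>Z_compensator: "is_compensator M F T (jump_measure T Z) \<pi>Z"
    and Z_decomposition:
      "\<exists>J. compensated_integral M F T (jump_measure T Z) \<pi>Z (\<lambda>_ (u, z). z) J \<and>
         (AE \<omega> in M. \<forall>t\<in>{0..T}.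
            Z t \<omega> = z0 + Zc t \<omega> + J t \<omega> + set_lebesgue_integral lborel {0..t} (\<lambda>u. bZ u \<omega>))"
    and \<nu>_kernel: "levy_kernel M T \<nu>"
    and \<pi>Z_density:
      "\<And>\<omega> B. \<omega> \<in> space M \<Longrightarrow> B \<in> sets (time_mark_space T) \<Longrightarrow>
         emeasure (\<pi>Z \<omega>) B = (\<integral>\<^sup>+ t. emeasure (\<nu> t \<omega>) {z. (t, z) \<in> B} \<partial>time_space T)"
    and Zc_bracket:
      "\<exists>A. angle_bracket M F T Zc A \<and>
         (AE \<omega> in M. \<forall>t\<in>{0..T}. A t \<omega> = set_lebesgue_integral lborel {0..t} (\<lambda>u. \<bar>aZ u \<omega>\<bar>\<^sup>2))"
    and aZ_bounded:
      "Lp_norm (M \<Otimes>\<^sub>M time_space T) \<infinity> (\<lambda>(\<omega>, t). ennreal \<bar>aZ t \<omega>\<bar>) < \<infinity>"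
    and bZ_bounded:
      "Lp_norm M \<infinity> (\<lambda>\<omega>. \<integral>\<^sup>+ u. ennreal (\<bar>bZ u \<omega>\<bar>\<^sup>2) \<partial>time_space T) < \<infinity>"
    and \<nu>_bounded:
      "Lp_norm (M \<Otimes>\<^sub>M time_space T) \<infinity> (\<lambda>(\<omega>, t). \<integral>\<^sup>+ z. ennreal (z\<^sup>2) \<partial>\<nu> t \<omega>) < \<infinity>"

locale price_process = driving_process M F T Z z0 Zc \<pi>Z \<nu> aZ bZ
  for M :: "'a measure" and F T Z z0 Zc \<pi>Z \<nu> aZ bZ +
  fixes S :: "'a process" and s0 :: real and R\<^sub>S :: "real set" and \<sigma> :: "real \<Rightarrow> real"
  assumes R\<^sub>S_open: "open R\<^sub>S"
    and s0_mem: "s0 \<in> R\<^sub>S"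
    and \<sigma>_pos: "\<And>x. x \<in> R\<^sub>S \<Longrightarrow> 0 < \<sigma> x"
    and \<sigma>_lipschitz: "\<exists>L. L-lipschitz_on R\<^sub>S \<sigma>"
    and S_CL: "S \<in> CL M F T"
    and S_mem: "\<And>\<omega> t. \<omega> \<in> space M \<Longrightarrow> t \<in> {0..T} \<Longrightarrow> S t \<omega> \<in> R\<^sub>S \<and> left_limit S t \<omega> \<in> R\<^sub>S"
    and S_solution:
      "\<exists>I. stochastic_integral M F T (\<lambda>t \<omega>. \<sigma> (left_limit S t \<omega>)) Z I \<and>
         (AE \<omega> in M. \<forall>t\<in>{0..T}. S t \<omega> = s0 + I t \<omega>)"


section \<open>Time-nets\<close>

text \<open>Deterministic nets are represented by the list of their knots.\<close>

definition T_det :: "real \<Rightarrow> real list set" where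
  "T_det T = {ts. 2 \<le> length ts \<and> sorted_wrt (<) ts \<and> hd ts = 0 \<and> last ts = T}"

text \<open>\<open>x\<^sup>\<kappa>\<close> for \<open>x, \<kappa> \<ge> 0\<close>, with \<open>0\<^sup>0 = 1\<close> (whereas \<open>0 powr 0 = 0\<close>).\<close>

definition npow :: "real \<Rightarrow> real \<Rightarrow> real" where
  "npow x \<kappa> = (if \<kappa> = 0 then 1 else x powr \<kappa>)"

text \<open>The case distinction implements \<open>inf \<emptyset> = \<infinity>\<close>.\<close>

fun rho :: "real \<Rightarrow> (real \<Rightarrow> real) \<Rightarrow> 'a process \<Rightarrow> real \<Rightarrow> real \<Rightarrow> nat \<Rightarrow> 'a \<Rightarrow> real" where
  "rho T \<sigma> S \<epsilon> \<kappa> 0 \<omega> = 0"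
| "rho T \<sigma> S \<epsilon> \<kappa> (Suc i) \<omega> =
     (let A = {t \<in> {rho T \<sigma> S \<epsilon> \<kappa> i \<omega> <.. T}.
                 \<bar>jump S t \<omega>\<bar> > \<sigma> (left_limit S t \<omega>) * \<epsilon> * npow (T - t) \<kappa>}
      in if A = {} then T else min (Inf A) T)"

definition combined_net ::
  "real \<Rightarrow> (real \<Rightarrow> real) \<Rightarrow> 'a process \<Rightarrow> real list \<Rightarrow> real \<Rightarrow> real \<Rightarrow> 'a \<Rightarrow> real set" where
  "combined_net T \<sigma> S \<tau> \<epsilon> \<kappa> \<omega> = set \<tau> \<union> range (\<lambda>i. rho T \<sigma> S \<epsilon> \<kappa> i \<omega>)"

text \<open>The number of distinct knots may be infinite.\<close>

definition num_knots :: "real set \<Rightarrow> ennreal" where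
  "num_knots A = emeasure (count_space UNIV) A"

end

theory Submission
  imports Defs
begin

text \<open>
  The jumps of \<open>S\<close> are \<open>\<sigma>(S\<^sub>-) \<Delta>Z\<close>, so up to the knots of \<open>\<tau>\<close> the net consists of the set \<open>J\<close> of
  times \<open>t\<close> with \<open>\<bar>\<Delta>Z\<^sub>t\<bar> > \<epsilon> (T - t)\<^sup>\<kappa>\<close>. The compensator of the counting process of \<open>J\<close> is at most
  \<open>\<integral> C (\<epsilon>\<^sup>-\<^sup>\<alpha> (T - t)\<^sup>-\<^sup>\<kappa>\<^sup>\<alpha> + 1) dt\<close>, which is \<open>O(n)\<close> since \<open>\<kappa> \<alpha> < 1\<close> and \<open>\<epsilon>\<^sub>n\<^sup>-\<^sup>\<alpha> = O(n)\<close>. Since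
  \<open>#J\<^sup>2 = \<Sum>\<^bsub>s\<in>J\<^esub> (2 #(J \<inter> (0,s)) + 1)\<close> with a predictable summand, the compensator also yields
  \<open>E #J\<^sup>2 = O(n\<^sup>2)\<close>, and Hoelder's inequality transfers this to \<open>L\<^sub>q(Q)\<close>. The lower bound is
  immediate from the \<open>n + 1\<close> knots of \<open>\<tau>\<close>.
\<close>

section \<open>Extended cardinality\<close>

abbreviation ecard :: "'a set \<Rightarrow> ennreal" where
  "ecard A \<equiv> emeasure (count_space UNIV) A"

lemma ecard_leI:
  assumes "\<And>E. finite E \<Longrightarrow> E \<subseteq> A \<Longrightarrow> of_nat (card E) \<le> c"
  shows "ecard A \<le> c"
proof (cases "finite A")
  case False
  have "of_nat n \<le> c" for n
    using infinite_arbitrarily_large[OF False, of n] assms by blast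
  then have "(SUP n. of_nat n) \<le> c" by (rule SUP_least)
  then have "c = \<infinity>" unfolding ennreal_SUP_of_nat_eq_top by (simp add: top_unique)
  then show ?thesis by simp
qed (use assms in simp)

lemma ecard_image_le: "ecard (f ` A) \<le> ecard A"
  by (cases "finite A") (simp_all add: card_image_le)

lemma ecard_conv_nn_integral: "ecard A = (\<integral>\<^sup>+ x. 1 \<partial>count_space A)"
  by (cases "finite A") simp_all

text \<open>The image under \<open>x \<mapsto> \<lceil>(k + 1) x\<rceil>\<close> counts the cells \<open>(i / (k + 1), (i + 1) / (k + 1)]\<close> that
  meet \<open>A\<close>, and finitely many points lie in distinct cells once the mesh is fine.\<close>

lemma ecard_eq_SUP_ceiling:
  fixes A :: "real set"
  shows "ecard A = (SUP k::nat. ecard ((\<lambda>x. \<lceil>real (Suc k) * x\<rceil>) ` A))"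
proof (intro antisym SUP_least ecard_image_le ecard_leI)
  fix E assume E: "finite E" "E \<subseteq> A"
  then have "uniform_discrete E" using uniform_discrete_finite_iff by blast
  then obtain d where d: "d > 0" "\<And>x y. x \<in> E \<Longrightarrow> y \<in> E \<Longrightarrow> dist x y < d \<Longrightarrow> x = y"
    unfolding uniform_discrete_def by blast
  obtain k where k: "1 / real (Suc k) < d" using nat_approx_posE[OF d(1)] by blast
  have inj: "inj_on (\<lambda>x. \<lceil>real (Suc k) * x\<rceil>) E"
  proof (rule inj_onI)
    fix x y assume xy: "x \<in> E" "y \<in> E" "\<lceil>real (Suc k) * x\<rceil> = \<lceil>real (Suc k) * y\<rceil>"
    have "real (Suc k) * dist x y = \<bar>real (Suc k) * x - real (Suc k) * y\<bar>"
      by (simp add: dist_real_def abs_mult right_diff_distrib[symmetric] del: of_nat_Suc)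
    also have "\<dots> < 1" using xy(3) by linarith
    finally have "dist x y < 1 / real (Suc k)" by (simp add: field_simps)
    then show "x = y" using d(2)[OF xy(1,2)] k by simp
  qed
  have "of_nat (card E) = ecard ((\<lambda>x. \<lceil>real (Suc k) * x\<rceil>) ` E)"
    using E(1) card_image[OF inj] by (simp del: of_nat_Suc)
  also have "\<dots> \<le> ecard ((\<lambda>x. \<lceil>real (Suc k) * x\<rceil>) ` A)" using E(2) by (intro emeasure_mono) auto
  also have "\<dots> \<le> (SUP k::nat. ecard ((\<lambda>x. \<lceil>real (Suc k) * x\<rceil>) ` A))" by (rule SUP_upper) simp
  finally show "of_nat (card E) \<le> (SUP k::nat. ecard ((\<lambda>x. \<lceil>real (Suc k) * x\<rceil>) ` A))" .
qed

lemma borel_measurable_ecard: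
  fixes A :: "'a \<Rightarrow> real set"
  assumes hit: "\<And>c d. c < d \<Longrightarrow> {\<omega>\<in>space M. A \<omega> \<inter> {c<..d} \<noteq> {}} \<in> sets M"
  shows "(\<lambda>\<omega>. ecard (A \<omega>)) \<in> borel_measurable M"
proof -
  define C where "C k \<omega> = (\<lambda>x. \<lceil>real (Suc k) * x\<rceil>) ` A \<omega>" for k \<omega>
  have cell: "{\<omega>\<in>space M. i \<in> C k \<omega>} \<in> sets M" for k i
  proof -
    have "i = \<lceil>real (Suc k) * x\<rceil> \<longleftrightarrow> x \<in> {(of_int i - 1) / real (Suc k)<..of_int i / real (Suc k)}"
      for x
      by (simp add: eq_commute[of i] ceiling_eq_iff field_simps)
    then have "i \<in> C k \<omega> \<longleftrightarrow> A \<omega> \<inter> {(of_int i - 1) / real (Suc k)<..of_int i / real (Suc k)} \<noteq> {}"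
      for \<omega>
      unfolding C_def image_iff by blast
    then show ?thesis using hit by (simp add: divide_strict_right_mono)
  qed
  have "(\<lambda>p. indicator (C k (snd p)) (fst p) :: ennreal) \<in>
      borel_measurable (count_space UNIV \<Otimes>\<^sub>M M)" for k
    unfolding indicator_def of_bool_def using cell
    by (intro measurable_pair_measure_countable1) (auto intro!: measurable_If)
  then have "(\<lambda>(\<omega>, i). indicator (C k \<omega>) i :: ennreal) \<in> borel_measurable (M \<Otimes>\<^sub>M count_space UNIV)"
    for k
    by (subst measurable_pair_swap_iff) (simp add: case_prod_beta)
  then have "(\<lambda>\<omega>. \<integral>\<^sup>+ i. indicator (C k \<omega>) i \<partial>count_space UNIV) \<in> borel_measurable M" for k
    by (rule sigma_finite_measure.borel_measurable_nn_integral[OF sigma_finite_measure_count_space])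
  then show ?thesis
    by (subst ecard_eq_SUP_ceiling) (simp add: C_def)
qed

lemma sum_rank_eq_square:
  fixes A :: "'a::linorder set"
  assumes "finite A"
  shows "(\<Sum>s\<in>A. 2 * card {u\<in>A. u < s} + 1) = (card A)\<^sup>2"
  using assms
proof (induction A rule: finite_linorder_max_induct)
  case (insert b A)
  have below_max: "{u \<in> insert b A. u < b} = A" using insert by auto
  have below: "{u \<in> insert b A. u < s} = {u \<in> A. u < s}" if "s \<in> A" for s
    using insert that by force
  have "b \<notin> A" using insert by auto
  then have "(\<Sum>s\<in>insert b A. 2 * card {u \<in> insert b A. u < s} + 1)
     = (2 * card A + 1) + (\<Sum>s\<in>A. 2 * card {u \<in> A. u < s} + 1)"
    unfolding sum.insert[OF insert(1) \<open>b \<notin> A\<close>] below_max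
    by (intro arg_cong2[where f="(+)"] sum.cong refl) (simp only: below)
  also have "\<dots> = (card (insert b A))\<^sup>2"
    using insert \<open>b \<notin> A\<close> by (simp add: power2_eq_square)
  finally show ?case .
qed simp

lemma ecard_square_eq_nn_integral:
  fixes A :: "'a::linorder set"
  shows "(ecard A)\<^sup>2 = (\<integral>\<^sup>+ s. 2 * ecard (A \<inter> {..<s}) + 1 \<partial>count_space A)"
proof (cases "finite A")
  case True
  have "(ecard A)\<^sup>2 = of_nat (\<Sum>s\<in>A. 2 * card {u\<in>A. u < s} + 1)"
    using True by (simp only: sum_rank_eq_square[OF True]) simp
  also have "\<dots> = (\<Sum>s\<in>A. 2 * ecard (A \<inter> {..<s}) + 1)"
    using True by (simp add: lessThan_def Int_def add.commute)
  finally show ?thesis using True by (simp add: nn_integral_count_space_finite)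
next
  case False
  then have "\<infinity> = (\<integral>\<^sup>+ s. 1 \<partial>count_space A)" by simp
  also have "\<dots> \<le> (\<integral>\<^sup>+ s. 2 * ecard (A \<inter> {..<s}) + 1 \<partial>count_space A)"
    by (intro nn_integral_mono) simp
  finally show ?thesis using False by (simp add: power_top_ennreal top_unique)
qed

lemma ecard_lessThan_eq_SUP:
  fixes A :: "real set"
  assumes "A \<subseteq> {0<..}"
  shows "ecard (A \<inter> {..<s}) = (SUP q\<in>\<rat> \<inter> {0<..<s}. ecard (A \<inter> {..q}))"
proof (intro antisym ecard_leI)
  show "(SUP q\<in>\<rat> \<inter> {0<..<s}. ecard (A \<inter> {..q})) \<le> ecard (A \<inter> {..<s})"
    by (intro SUP_least emeasure_mono) auto
  fix E assume E: "finite E" "E \<subseteq> A \<inter> {..<s}"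
  show "of_nat (card E) \<le> (SUP q\<in>\<rat> \<inter> {0<..<s}. ecard (A \<inter> {..q}))"
  proof (cases "E = {}")
    case False
    then have "Max E \<in> E" using E(1) by simp
    then have "0 < Max E" "Max E < s" using E(2) assms by auto
    then obtain q where q: "q \<in> \<rat>" "Max E < q" "q < s" using Rats_dense_in_real by blast
    then have "E \<subseteq> A \<inter> {..q}" using E by (fastforce dest: Max_ge)
    then have "of_nat (card E) \<le> ecard (A \<inter> {..q})"
      using E(1) emeasure_mono[of E "A \<inter> {..q}" "count_space UNIV"] by simp
    also have "\<dots> \<le> (SUP q\<in>\<rat> \<inter> {0<..<s}. ecard (A \<inter> {..q}))"
      using q \<open>0 < Max E\<close> by (intro SUP_upper) auto
    finally show ?thesis .
  qed simp
qed


section \<open>Jumps of cadlag paths\<close>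

lemma frequently_Rats_at_left: "\<exists>\<^sub>F x in at_left (t::real). x \<in> \<rat>"
  unfolding frequently_def eventually_at_left_field using Rats_dense_in_real by blast

lemma frequently_Rats_at_right: "\<exists>\<^sub>F x in at_right (t::real). x \<in> \<rat>"
  unfolding frequently_def eventually_at_right_field using Rats_dense_in_real by blast

lemma jump_eqI:
  assumes "((\<lambda>s. X s \<omega>) \<longlongrightarrow> l) (at_left t)" "t \<noteq> 0"
  shows "jump X t \<omega> = X t \<omega> - l"
  using assms by (simp add: jump_def left_limit_def tendsto_Lim)

lemma cadlag_path_tendsto_at_left:
  assumes "cadlag_path T (\<lambda>t. X t \<omega>)" "t \<in> {0<..T}"
  shows "((\<lambda>s. X s \<omega>) \<longlongrightarrow> X t \<omega> - jump X t \<omega>) (at_left t)"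
proof -
  obtain l where "((\<lambda>s. X s \<omega>) \<longlongrightarrow> l) (at_left t)"
    using assms unfolding cadlag_path_def by blast
  moreover from this have "jump X t \<omega> = X t \<omega> - l" using assms(2) by (intro jump_eqI) auto
  ultimately show ?thesis by simp
qed

lemma cadlag_path_tendsto_at_right:
  assumes "cadlag_path T f" "t \<in> {0..<T}"
  shows "(f \<longlongrightarrow> f t) (at_right t)"
  using assms unfolding cadlag_path_def by blast

lemma cadlag_path_right_neighbourhood:
  assumes f: "cadlag_path T f" and t: "t \<in> {0..T}" and e: "0 < e"
  obtains b where "t < b" "\<And>v. \<lbrakk>t \<le> v; v < b; v \<le> T\<rbrakk> \<Longrightarrow> \<bar>f v - f t\<bar> < e"
proof (cases "t = T")
  case True
  show ?thesis by (rule that[of "T + 1"]) (use True e in auto)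
next
  case False
  then have "\<forall>\<^sub>F v in at_right t. dist (f v) (f t) < e"
    using cadlag_path_tendsto_at_right[OF f, of t] t e by (intro tendstoD) auto
  then obtain b where b: "t < b" "\<And>v. t < v \<Longrightarrow> v < b \<Longrightarrow> \<bar>f v - f t\<bar> < e"
    unfolding eventually_at_right_field dist_real_def by blast
  show ?thesis
  proof (rule that[OF b(1)])
    show "\<bar>f v - f t\<bar> < e" if "t \<le> v" "v < b" for v
      using b(2)[of v] that e by (cases "v = t") auto
  qed
qed

lemma cadlag_path_increments_le_jump:
  assumes X: "cadlag_path T (\<lambda>t. X t \<omega>)" and t: "t \<in> {0<..T}" and e: "0 < e"
  obtains d where "0 < d"
    "\<And>u v. \<lbrakk>u < v; v \<le> T; \<bar>u - t\<bar> < d; \<bar>v - t\<bar> < d\<rbrakk> \<Longrightarrow> \<bar>X v \<omega> - X u \<omega>\<bar> < \<bar>jump X t \<omega>\<bar> + e"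
proof -
  define l where "l = X t \<omega> - jump X t \<omega>"
  have "\<forall>\<^sub>F u in at_left t. dist (X u \<omega>) l < e / 2"
    using cadlag_path_tendsto_at_left[where X=X and \<omega>=\<omega>, OF X t] e
    unfolding l_def by (intro tendstoD) auto
  then obtain a where a: "a < t" "\<And>u. a < u \<Longrightarrow> u < t \<Longrightarrow> \<bar>X u \<omega> - l\<bar> < e / 2"
    unfolding eventually_at_left_field dist_real_def by blast
  obtain b where b: "t < b" "\<And>v. \<lbrakk>t \<le> v; v < b; v \<le> T\<rbrakk> \<Longrightarrow> \<bar>X v \<omega> - X t \<omega>\<bar> < e / 2"
    using cadlag_path_right_neighbourhood[OF X, of t "e / 2"] t e by auto
  show ?thesis
  proof (rule that[of "min (t - a) (b - t)"])
    fix u v assume uv: "u < v" "v \<le> T" "\<bar>u - t\<bar> < min (t - a) (b - t)"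
      "\<bar>v - t\<bar> < min (t - a) (b - t)"
    then have "a < u" "v < b" by linarith+
    consider (left) "v < t" | (right) "t \<le> u" | (across) "u < t" "t \<le> v" by linarith
    then show "\<bar>X v \<omega> - X u \<omega>\<bar> < \<bar>jump X t \<omega>\<bar> + e"
    proof cases
      case left
      then show ?thesis using a(2)[of u] a(2)[of v] uv \<open>a < u\<close> by linarith
    next
      case right
      then show ?thesis using b(2)[of u] b(2)[of v] uv \<open>v < b\<close> by linarith
    next
      case across
      then show ?thesis
        using a(2)[of u] b(2)[of v] uv \<open>a < u\<close> \<open>v < b\<close> unfolding l_def by linarith
    qed
  qed (use a b in simp)
qed

definition dense_times :: "real \<Rightarrow> real \<Rightarrow> real set" where
  "dense_times a b = insert b ({a<..b} \<inter> \<rat>)"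

lemma countable_dense_times: "countable (dense_times a b)"
  unfolding dense_times_def by (intro countable_insert countable_Int2 countable_rat)

lemma dense_times_subset: "a < b \<Longrightarrow> dense_times a b \<subseteq> {a<..b}"
  by (auto simp: dense_times_def)

lemma cadlag_path_jump_witness:
  assumes X: "cadlag_path T (\<lambda>t. X t \<omega>)" and t: "t \<in> {0<..T}"
    and g: "(g \<longlongrightarrow> g t) (at_left t)" and jump: "g t + c < \<bar>jump X t \<omega>\<bar>"
    and a: "a \<le> a'" "a' < t" and b: "t \<le> b" "b \<le> T" and e: "0 < e"
  obtains u v where "u \<in> dense_times a b" "v \<in> dense_times a b" "a' < u" "u < v" "v - u < e"
    "g u + c < \<bar>X v \<omega> - X u \<omega>\<bar>"
proof -
  have "((\<lambda>u. \<bar>X t \<omega> - X u \<omega>\<bar> - g u) \<longlongrightarrow> \<bar>X t \<omega> - (X t \<omega> - jump X t \<omega>)\<bar> - g t) (at_left t)"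
    by (intro tendsto_intros cadlag_path_tendsto_at_left[where X=X and \<omega>=\<omega>, OF X t] g)
  then have "\<forall>\<^sub>F u in at_left t. c < \<bar>X t \<omega> - X u \<omega>\<bar> - g u"
    by (rule order_tendstoD) (use jump in simp)
  moreover have "\<forall>\<^sub>F u in at_left t. u \<in> {max a' (t - e / 2)<..<t}"
    using a e by (intro eventually_at_left_real) auto
  ultimately have "\<forall>\<^sub>F u in at_left t. c < \<bar>X t \<omega> - X u \<omega>\<bar> - g u \<and> u \<in> {max a' (t - e / 2)<..<t}"
    by eventually_elim auto
  from frequently_ex[OF frequently_eventually_conj[OF frequently_Rats_at_left this]]
  obtain u where u: "u \<in> \<rat>" "c < \<bar>X t \<omega> - X u \<omega>\<bar> - g u" "a' < u" "t - e / 2 < u" "u < t" by auto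
  have u_mem: "u \<in> dense_times a b" using u a b by (auto simp: dense_times_def)
  show ?thesis
  proof (cases "t = b")
    case True
    show ?thesis by (rule that[OF u_mem, of b]) (use True u e in \<open>auto simp: dense_times_def\<close>)
  next
    case False
    have "((\<lambda>v. \<bar>X v \<omega> - X u \<omega>\<bar>) \<longlongrightarrow> \<bar>X t \<omega> - X u \<omega>\<bar>) (at_right t)"
      using False t b by (intro tendsto_intros cadlag_path_tendsto_at_right[OF X]) auto
    then have "\<forall>\<^sub>F v in at_right t. g u + c < \<bar>X v \<omega> - X u \<omega>\<bar>"
      by (rule order_tendstoD) (use u in simp)
    moreover have "\<forall>\<^sub>F v in at_right t. v \<in> {t<..<min b (t + e / 2)}"
      using False b e by (intro eventually_at_right_real) auto
    ultimately have "\<forall>\<^sub>F v in at_right t. g u + c < \<bar>X v \<omega> - X u \<omega>\<bar> \<and> v \<in> {t<..<min b (t + e / 2)}"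
      by eventually_elim auto
    from frequently_ex[OF frequently_eventually_conj[OF frequently_Rats_at_right this]]
    obtain v where v: "v \<in> \<rat>" "g u + c < \<bar>X v \<omega> - X u \<omega>\<bar>" "t < v" "v < b" "v < t + e / 2" by auto
    then have "v \<in> dense_times a b" using a by (auto simp: dense_times_def)
    then show ?thesis using that u u_mem v by auto
  qed
qed

lemma cadlag_path_jump_of_increments:
  assumes X: "cadlag_path T (\<lambda>t. X t \<omega>)" and g: "continuous_on {0..T} g"
    and ab: "0 \<le> a" "b \<le> T" and c_pos: "0 < c"
    and u: "\<And>k. a + c \<le> u k" and v: "\<And>k. v k \<le> b"
    and uv: "\<And>k::nat. u k < v k" "(\<lambda>k. v k - u k) \<longlonglongrightarrow> 0"
    and increments: "\<And>k. g (u k) + c \<le> \<bar>X (v k) \<omega> - X (u k) \<omega>\<bar>"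
  shows "\<exists>s\<in>{a<..b}. g s < \<bar>jump X s \<omega>\<bar>"
proof -
  have u_range: "u k \<in> {a + c..b}" for k using u[of k] v[of k] uv(1)[of k] by simp
  then obtain s r where s: "s \<in> {a + c..b}" and r: "strict_mono r" "(u \<circ> r) \<longlonglongrightarrow> s"
    using compact_Icc[of "a + c" b] unfolding compact_def by metis
  have s_range: "s \<in> {a<..b}" "s \<in> {0<..T}" using s ab c_pos by auto
  obtain d where d: "0 < d"
    "\<And>u v. \<lbrakk>u < v; v \<le> T; \<bar>u - s\<bar> < d; \<bar>v - s\<bar> < d\<rbrakk> \<Longrightarrow> \<bar>X v \<omega> - X u \<omega>\<bar> < \<bar>jump X s \<omega>\<bar> + c / 2"
    using cadlag_path_increments_le_jump[where X=X and \<omega>=\<omega>, OF X s_range(2), of "c / 2"] c_pos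
    by auto
  have "(\<lambda>j. u (r j)) \<longlonglongrightarrow> s" using r(2) by (simp add: o_def)
  moreover from tendsto_add[OF this LIMSEQ_subseq_LIMSEQ[OF uv(2) r(1)]]
  have "(\<lambda>j. v (r j)) \<longlonglongrightarrow> s" by (simp add: o_def)
  ultimately have "\<forall>\<^sub>F j in sequentially. dist (u (r j)) s < d"
    "\<forall>\<^sub>F j in sequentially. dist (v (r j)) s < d"
    using d(1) by (auto intro: tendstoD)
  moreover have "(\<lambda>j. g (u (r j))) \<longlonglongrightarrow> g s"
  proof (rule continuous_on_tendsto_compose[OF g \<open>(\<lambda>j. u (r j)) \<longlonglongrightarrow> s\<close>])
    have "u k \<in> {0..T}" for k using u_range[of k] ab c_pos by simp
    then show "\<forall>\<^sub>F j in sequentially. u (r j) \<in> {0..T}" by simp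
  qed (use s_range in simp)
  then have "\<forall>\<^sub>F j in sequentially. g s - c / 2 < g (u (r j))"
    by (rule order_tendstoD) (use c_pos in simp)
  ultimately have "\<forall>\<^sub>F j in sequentially.
      dist (u (r j)) s < d \<and> dist (v (r j)) s < d \<and> g s - c / 2 < g (u (r j))"
    by eventually_elim auto
  then obtain j where j: "\<bar>u (r j) - s\<bar> < d" "\<bar>v (r j) - s\<bar> < d" "g s - c / 2 < g (u (r j))"
    using eventually_happens'[OF sequentially_bot] unfolding dist_real_def by blast
  have "\<bar>X (v (r j)) \<omega> - X (u (r j)) \<omega>\<bar> < \<bar>jump X s \<omega>\<bar> + c / 2"
    using d(2)[OF uv(1) _ j(1,2)] v[of "r j"] ab by simp
  then have "g s < \<bar>jump X s \<omega>\<bar>" using increments[of "r j"] j(3) by linarith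
  then show ?thesis using s_range(1) by blast
qed

definition has_big_increment ::
  "real \<Rightarrow> real \<Rightarrow> (real \<Rightarrow> real) \<Rightarrow> (real \<Rightarrow> real) \<Rightarrow> nat \<Rightarrow> nat \<Rightarrow> bool" where
  "has_big_increment a b g f m k \<longleftrightarrow> (\<exists>u\<in>dense_times a b. \<exists>v\<in>dense_times a b.
     a + 1 / Suc m \<le> u \<and> u < v \<and> v - u < 1 / Suc k \<and> g u + 1 / Suc m \<le> \<bar>f v - f u\<bar>)"

lemma cadlag_path_jump_iff:
  assumes X: "cadlag_path T (\<lambda>t. X t \<omega>)" and g: "continuous_on {0..T} g"
    and ab: "0 \<le> a" "a < b" "b \<le> T"
  shows "(\<exists>s\<in>{a<..b}. g s < \<bar>jump X s \<omega>\<bar>) \<longleftrightarrow>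
    (\<exists>m. \<forall>k. has_big_increment a b g (\<lambda>t. X t \<omega>) m k)"
    (is "?jump \<longleftrightarrow> ?increments")
proof
  assume ?jump
  then obtain s where s: "a < s" "s \<le> b" "g s < \<bar>jump X s \<omega>\<bar>" by auto
  then have g_left: "(g \<longlongrightarrow> g s) (at_left s)"
    using ab by (intro continuous_on_Icc_at_leftD[of 0] continuous_on_subset[OF g]) auto
  obtain m :: nat where "1 / Suc m < min (\<bar>jump X s \<omega>\<bar> - g s) (s - a)"
    using s nat_approx_posE[of "min (\<bar>jump X s \<omega>\<bar> - g s) (s - a)"] by auto
  then have m: "g s + 1 / Suc m < \<bar>jump X s \<omega>\<bar>" "a + 1 / Suc m < s" by linarith+
  show ?increments
  proof (intro exI[of _ m] allI)
    fix k :: nat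
    have "s \<in> {0<..T}" using s ab by auto
    then obtain u v where "u \<in> dense_times a b" "v \<in> dense_times a b" "a + 1 / Suc m < u" "u < v"
      "v - u < 1 / Suc k" "g u + 1 / Suc m < \<bar>X v \<omega> - X u \<omega>\<bar>"
      using cadlag_path_jump_witness[where X=X and \<omega>=\<omega> and a=a and e="1 / Suc k",
          OF X _ g_left m(1) _ m(2) s(2) ab(3)] by auto
    then show "has_big_increment a b g (\<lambda>t. X t \<omega>) m k"
      unfolding has_big_increment_def by (meson less_imp_le)
  qed
next
  assume ?increments
  then obtain m u v where uv: "\<And>k. u k \<in> dense_times a b" "\<And>k. v k \<in> dense_times a b"
    "\<And>k. a + 1 / Suc m \<le> u k" "\<And>k. u k < v k" "\<And>k::nat. v k - u k < 1 / Suc k"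
    "\<And>k. g (u k) + 1 / Suc m \<le> \<bar>X (v k) \<omega> - X (u k) \<omega>\<bar>"
    unfolding has_big_increment_def by metis
  have "(\<lambda>k. v k - u k) \<longlonglongrightarrow> 0"
    using uv(4,5)
    by (intro real_tendsto_sandwich[OF _ _ tendsto_const LIMSEQ_inverse_real_of_nat])
      (auto intro!: always_eventually less_imp_le simp: inverse_eq_divide)
  moreover have "v k \<le> b" for k using uv(2)[of k] dense_times_subset[OF ab(2)] by auto
  ultimately show ?jump
    using uv(3,4,6) ab
    by (intro cadlag_path_jump_of_increments[where X=X and \<omega>=\<omega> and u=u and v=v, OF X g]) auto
qed


section \<open>Measurability of jump counts\<close>

definition jump_times :: "real \<Rightarrow> 'a process \<Rightarrow> (real \<Rightarrow> real) \<Rightarrow> 'a \<Rightarrow> real set" where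
  "jump_times T X g \<omega> = {t \<in> {0<..T}. g t < \<bar>jump X t \<omega>\<bar>}"

context filtered_prob_space
begin

lemma subalgebra_F_mono: "s \<le> t \<Longrightarrow> subalgebra (F t) (F s)"
  using sets_F_mono by (simp add: subalgebra_def space_F)

lemma subalgebra_F: "subalgebra M (F t)"
  using F_sub by (simp add: subalgebra_def space_F)

lemma CL_cadlag_path: "X \<in> CL M F T \<Longrightarrow> \<omega> \<in> space M \<Longrightarrow> cadlag_path T (\<lambda>t. X t \<omega>)"
  by (simp add: CL_def)

lemma CL_measurable_F: "X \<in> CL M F T \<Longrightarrow> 0 \<le> s \<Longrightarrow> s \<le> t \<Longrightarrow> s \<le> T \<Longrightarrow> X s \<in> borel_measurable (F t)"
  by (rule measurable_from_subalg[OF subalgebra_F_mono]) (auto simp: CL_def adapted_def)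

lemma CL_measurable: "X \<in> CL M F T \<Longrightarrow> t \<in> {0..T} \<Longrightarrow> X t \<in> borel_measurable M"
  by (rule measurable_from_subalg[OF subalgebra_F[of t]]) (auto simp: CL_def adapted_def)

lemma sets_jump_times_hit:
  assumes X: "X \<in> CL M F T" and g: "continuous_on {0..T} g" and ab: "0 \<le> a" "a < b" "b \<le> T"
  shows "{\<omega>\<in>space M. jump_times T X g \<omega> \<inter> {a<..b} \<noteq> {}} \<in> sets (F b)"
proof -
  have X_meas: "X u \<in> borel_measurable (F b)" if "u \<in> dense_times a b" for u
    using that dense_times_subset[OF ab(2)] ab by (intro CL_measurable_F[OF X]) auto
  have "jump_times T X g \<omega> \<inter> {a<..b} \<noteq> {} \<longleftrightarrow> (\<exists>m. \<forall>k. has_big_increment a b g (\<lambda>t. X t \<omega>) m k)"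
    if "\<omega> \<in> space M" for \<omega>
  proof -
    have "jump_times T X g \<omega> \<inter> {a<..b} = {s\<in>{a<..b}. g s < \<bar>jump X s \<omega>\<bar>}"
      using ab by (auto simp: jump_times_def)
    then have "jump_times T X g \<omega> \<inter> {a<..b} \<noteq> {} \<longleftrightarrow> (\<exists>s\<in>{a<..b}. g s < \<bar>jump X s \<omega>\<bar>)" by auto
    also note cadlag_path_jump_iff[where X=X and \<omega>=\<omega>, OF CL_cadlag_path[OF X that] g ab]
    finally show ?thesis .
  qed
  then have "{\<omega>\<in>space M. jump_times T X g \<omega> \<inter> {a<..b} \<noteq> {}} =
      {\<omega>\<in>space (F b). \<exists>m. \<forall>k. has_big_increment a b g (\<lambda>t. X t \<omega>) m k}"
    by (auto simp: space_F)
  also have "\<dots> \<in> sets (F b)"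
    unfolding has_big_increment_def using countable_dense_times X_meas
    by (intro sets.sets_Collect sets.sets_Collect_countable_Ex sets.sets_Collect_countable_All
      sets.sets_Collect_countable_Ex') measurable
  finally show ?thesis .
qed

lemma sets_jump_times_atMost_hit:
  assumes X: "X \<in> CL M F T" and g: "continuous_on {0..T} g" and b: "b \<le> T"
  shows "{\<omega>\<in>space M. jump_times T X g \<omega> \<inter> {..b} \<inter> {c<..d} \<noteq> {}} \<in> sets (F b)"
proof (cases "max 0 c < min b d")
  case True
  have "jump_times T X g \<omega> \<inter> {..b} \<inter> {c<..d} = jump_times T X g \<omega> \<inter> {max 0 c<..min b d}" for \<omega>
    by (auto simp: jump_times_def)
  moreover have "{\<omega>\<in>space M. jump_times T X g \<omega> \<inter> {max 0 c<..min b d} \<noteq> {}} \<in> sets (F (min b d))"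
    using True b by (intro sets_jump_times_hit[OF X g]) auto
  ultimately show ?thesis using sets_F_mono[of "min b d" b] by auto
next
  case False
  then have "jump_times T X g \<omega> \<inter> {..b} \<inter> {c<..d} = {}" for \<omega>
    by (auto simp: jump_times_def)
  then show ?thesis by simp
qed

lemma measurable_ecard_jump_times:
  assumes "X \<in> CL M F T" "continuous_on {0..T} g" "b \<le> T"
  shows "(\<lambda>\<omega>. ecard (jump_times T X g \<omega> \<inter> {..b})) \<in> borel_measurable (F b)"
  using sets_jump_times_atMost_hit[OF assms] by (intro borel_measurable_ecard) (simp add: space_F)

end


section \<open>Jumps of stochastic integrals\<close>

lemma cadlag_path_jump_diff_le:
  assumes X: "cadlag_path T (\<lambda>t. X t \<omega>)" and Y: "cadlag_path T (\<lambda>t. Y t \<omega>)" and t: "t \<in> {0<..T}"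
    and close: "\<And>s. s \<in> {0..T} \<Longrightarrow> \<bar>X s \<omega> - Y s \<omega>\<bar> \<le> e"
  shows "\<bar>jump X t \<omega> - jump Y t \<omega>\<bar> \<le> 2 * e"
proof -
  have "((\<lambda>s. \<bar>X s \<omega> - Y s \<omega>\<bar>) \<longlongrightarrow> \<bar>(X t \<omega> - jump X t \<omega>) - (Y t \<omega> - jump Y t \<omega>)\<bar>) (at_left t)"
    using X Y t by (intro tendsto_intros cadlag_path_tendsto_at_left[where T=T])
  moreover have "\<forall>\<^sub>F s in at_left t. \<bar>X s \<omega> - Y s \<omega>\<bar> \<le> e"
    using eventually_at_left_real[of 0 t] t close by (auto elim!: eventually_mono)
  ultimately have "\<bar>(X t \<omega> - jump X t \<omega>) - (Y t \<omega> - jump Y t \<omega>)\<bar> \<le> e"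
    by (rule tendsto_upperbound) simp
  then show ?thesis using close[of t] t by auto
qed

lemma tendsto_stopped_at_left:
  assumes "cadlag_path T (\<lambda>t. X t \<omega>)" "t \<in> {0<..T}"
  shows "((\<lambda>s. X (min r s) \<omega>) \<longlongrightarrow> X (min r t) \<omega> - indicator {..r} t * jump X t \<omega>) (at_left t)"
proof (cases "t \<le> r")
  case True
  have "((\<lambda>s. X s \<omega>) \<longlongrightarrow> X t \<omega> - jump X t \<omega>) (at_left t)"
    by (rule cadlag_path_tendsto_at_left) (use assms in auto)
  moreover have "\<forall>\<^sub>F s in at_left t. X s \<omega> = X (min r s) \<omega>"
    using True eventually_at_left_real[of "t - 1" t] by (auto elim!: eventually_mono simp: min_def)
  ultimately have "((\<lambda>s. X (min r s) \<omega>) \<longlongrightarrow> X t \<omega> - jump X t \<omega>) (at_left t)"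
    by (rule Lim_transform_eventually)
  then show ?thesis using True by (simp add: min_absorb2)
next
  case False
  have "\<forall>\<^sub>F s in at_left t. X r \<omega> = X (min r s) \<omega>"
    using False eventually_at_left_real[of r t] by (auto elim!: eventually_mono simp: min_def)
  then show ?thesis using False by (auto intro!: Lim_transform_eventually[OF tendsto_const])
qed

lemma tendsto_stopped_at_right:
  assumes "cadlag_path T f" "t \<in> {0..<T}"
  shows "((\<lambda>s. f (min r s)) \<longlongrightarrow> f (min r t)) (at_right t)"
proof (cases "t < r")
  case True
  then have "\<forall>\<^sub>F s in at_right t. f s = f (min r s)"
    using eventually_at_right_real[of t r] by (auto elim!: eventually_mono simp: min_def)
  with cadlag_path_tendsto_at_right[OF assms] have "((\<lambda>s. f (min r s)) \<longlongrightarrow> f t) (at_right t)"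
    by (rule Lim_transform_eventually)
  then show ?thesis using True by (simp add: min_absorb2)
next
  case False
  then have "\<forall>\<^sub>F s in at_right t. f r = f (min r s)"
    using eventually_at_right_real[of t "t + 1"] by (auto elim!: eventually_mono simp: min_def)
  then show ?thesis using False by (auto intro!: Lim_transform_eventually[OF tendsto_const])
qed

lemma tendsto_indicator_greaterThanAtMost_at_left:
  fixes a b t :: real
  shows "(indicator {a<..b} \<longlongrightarrow> (indicator {a<..b} t :: real)) (at_left t)"
proof (rule Lim_transform_eventually[OF tendsto_const])
  define c where "c = (if a < t then (if b < t then max a b else a) else t - 1)"
  have "c < t" by (auto simp: c_def)
  from eventually_at_left_real[OF this]
  show "\<forall>\<^sub>F s in at_left t. indicator {a<..b} t = (indicator {a<..b} s :: real)"
    by eventually_elim (auto simp: c_def indicator_def split: if_splits)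
qed

lemma simple_process_left_continuous:
  assumes "0 < t"
  shows "((\<lambda>s. simple_process D s \<omega>) \<longlongrightarrow> simple_process D t \<omega>) (at_left t)"
proof (cases D)
  case (fields k h0 \<tau> h)
  have "\<forall>\<^sub>F s in at_left t. 0 = (indicator {0} s :: real)"
    using eventually_at_left_real[OF assms] by (auto elim!: eventually_mono)
  then have "(indicator {0} \<longlongrightarrow> (indicator {0} t :: real)) (at_left t)"
    using assms by (auto intro!: Lim_transform_eventually[OF tendsto_const])
  then show ?thesis
    unfolding fields simple_process.simps
    by (intro tendsto_intros tendsto_indicator_greaterThanAtMost_at_left)
qed

definition grid_above :: "real \<Rightarrow> nat \<Rightarrow> real \<Rightarrow> real" where
  "grid_above T k x = min T (real (Suc (nat \<lfloor>real (Suc k) * x\<rfloor>)) / real (Suc k))"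

lemma filterlim_grid_above:
  assumes "0 \<le> x" "x < T"
  shows "filterlim (\<lambda>k. grid_above T k x) (at_right x) sequentially"
proof (rule tendsto_imp_filterlim_at_right)
  have bounds: "x < grid_above T k x \<and> grid_above T k x \<le> x + inverse (real (Suc k))" for k
  proof -
    define m where "m = real (Suc k)"
    have m: "0 < m" by (simp add: m_def)
    then have "real (nat \<lfloor>m * x\<rfloor>) = of_int \<lfloor>m * x\<rfloor>" using assms(1) by (intro of_nat_nat) simp
    then have "m * x < real (Suc (nat \<lfloor>m * x\<rfloor>))" "real (Suc (nat \<lfloor>m * x\<rfloor>)) \<le> m * x + 1"
      by linarith+
    then have "x < real (Suc (nat \<lfloor>m * x\<rfloor>)) / m" "real (Suc (nat \<lfloor>m * x\<rfloor>)) / m \<le> (m * x + 1) / m"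
      using m by (simp_all add: pos_less_divide_eq mult.commute divide_right_mono del: of_nat_Suc)
    moreover have "(m * x + 1) / m = x + inverse m" using m by (simp add: field_simps)
    ultimately show ?thesis using assms(2) by (simp add: grid_above_def m_def del: of_nat_Suc)
  qed
  show "(\<lambda>k. grid_above T k x) \<longlonglongrightarrow> x"
    by (rule real_tendsto_sandwich[OF _ _ tendsto_const LIMSEQ_inverse_real_of_nat_add])
      (use bounds in \<open>auto intro!: always_eventually less_imp_le simp del: of_nat_Suc\<close>)
  show "\<forall>\<^sub>F k in sequentially. x < grid_above T k x" using bounds by simp
qed

lemma grid_above_end:
  assumes "0 \<le> T"
  shows "grid_above T k T = T"
proof -
  from assms have "real (Suc k) * T \<le> real (Suc (nat \<lfloor>real (Suc k) * T\<rfloor>))"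
    by (simp add: le_nat_floor) linarith
  then show ?thesis by (simp add: grid_above_def pos_le_divide_eq mult.commute del: of_nat_Suc)
qed

context filtered_prob_space
begin

lemma measurable_CL_at_random_time:
  assumes X: "X \<in> CL M F T" and [measurable]: "R \<in> borel_measurable M"
    and R_range: "\<And>\<omega>. \<omega> \<in> space M \<Longrightarrow> R \<omega> \<in> {0..T}"
  shows "(\<lambda>\<omega>. X (R \<omega>) \<omega>) \<in> borel_measurable M"
proof (rule borel_measurable_LIMSEQ_real)
  fix k
  have "(\<lambda>\<omega>. nat \<lfloor>real (Suc k) * R \<omega>\<rfloor>) \<in> M \<rightarrow>\<^sub>M count_space UNIV" by measurable
  moreover have "(\<lambda>\<omega>. X (min T (real (Suc i) / real (Suc k))) \<omega>) \<in> borel_measurable M" for i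
    using T_pos by (intro CL_measurable[OF X]) auto
  ultimately show "(\<lambda>\<omega>. X (grid_above T k (R \<omega>)) \<omega>) \<in> borel_measurable M"
    unfolding grid_above_def by (rule measurable_compose_countable[rotated])
next
  fix \<omega> assume \<omega>: "\<omega> \<in> space M"
  show "(\<lambda>k. X (grid_above T k (R \<omega>)) \<omega>) \<longlonglongrightarrow> X (R \<omega>) \<omega>"
  proof (cases "R \<omega> = T")
    case True
    then show ?thesis using T_pos by (simp add: grid_above_end)
  next
    case False
    then have "R \<omega> \<in> {0..<T}" using R_range[OF \<omega>] by auto
    then show ?thesis
      using filterlim_compose[OF cadlag_path_tendsto_at_right[OF CL_cadlag_path[OF X \<omega>]]
          filterlim_grid_above]
      by simp
  qed
qed

lemma sets_exceedance:
  assumes meas: "\<And>t. t \<in> {0..T} \<Longrightarrow> Y t \<in> borel_measurable M"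
    and one_sided: "\<And>\<omega> t. \<omega> \<in> space M \<Longrightarrow> t \<in> {0<..<T} \<Longrightarrow>
      ((\<lambda>s. Y s \<omega>) \<longlongrightarrow> Y t \<omega>) (at_left t) \<or> ((\<lambda>s. Y s \<omega>) \<longlongrightarrow> Y t \<omega>) (at_right t)"
  shows "{\<omega>\<in>space M. \<exists>t\<in>{0..T}. e < \<bar>Y t \<omega> :: real\<bar>} \<in> sets M"
proof -
  define C where "C = insert 0 (dense_times 0 T)"
  have C: "countable C" "C \<subseteq> {0..T}"
    using countable_dense_times dense_times_subset[OF T_pos] T_pos by (auto simp: C_def)
  have "\<exists>t\<in>C. e < \<bar>Y t \<omega>\<bar>" if \<omega>: "\<omega> \<in> space M" and t: "t \<in> {0..T}" "e < \<bar>Y t \<omega>\<bar>" for \<omega> t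
  proof (cases "t \<in> {0, T}")
    case True
    then show ?thesis using t by (auto simp: C_def dense_times_def)
  next
    case False
    then have "t \<in> {0<..<T}" using t by auto
    from one_sided[OF \<omega> this] obtain G where G: "G = at_left t \<or> G = at_right t"
      and "((\<lambda>s. Y s \<omega>) \<longlongrightarrow> Y t \<omega>) G" by blast
    then have "\<forall>\<^sub>F s in G. e < \<bar>Y s \<omega>\<bar>" using t(2) by (intro order_tendstoD(1)[OF tendsto_rabs])
    moreover have "\<forall>\<^sub>F s in G. s \<in> {0<..<T}"
      using G eventually_at_left_real[of 0 t] eventually_at_right_real[of t T] \<open>t \<in> {0<..<T}\<close>
      by (auto elim: eventually_mono)
    ultimately have "\<forall>\<^sub>F s in G. e < \<bar>Y s \<omega>\<bar> \<and> s \<in> {0<..<T}" by (rule eventually_conj)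
    moreover have "\<exists>\<^sub>F s in G. s \<in> \<rat>"
      using G frequently_Rats_at_left frequently_Rats_at_right by blast
    ultimately have "\<exists>s. (e < \<bar>Y s \<omega>\<bar> \<and> s \<in> {0<..<T}) \<and> s \<in> \<rat>"
      by (intro frequently_ex[OF frequently_eventually_conj])
    then show ?thesis by (auto simp: C_def dense_times_def)
  qed
  then have "{\<omega>\<in>space M. \<exists>t\<in>{0..T}. e < \<bar>Y t \<omega>\<bar>} = {\<omega>\<in>space M. \<exists>t\<in>C. e < \<bar>Y t \<omega>\<bar>}"
    using C(2) by blast
  also have "\<dots> \<in> sets M"
  proof (rule sets.sets_Collect_countable_Ex'[OF _ C(1)])
    fix t assume "t \<in> C"
    then have [measurable]: "Y t \<in> borel_measurable M" using C meas by blast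
    show "{\<omega>\<in>space M. e < \<bar>Y t \<omega>\<bar>} \<in> sets M" by measurable
  qed
  finally show ?thesis .
qed

lemma subalgebra_pre_sigma:
  assumes \<tau>: "stopping_time F \<tau>" and \<tau>_le: "\<And>\<omega>. \<omega> \<in> space M \<Longrightarrow> \<tau> \<omega> \<le> T"
  shows "subalgebra M (pre_sigma \<tau>)"
  unfolding subalgebra_def
proof (intro conjI subsetI)
  fix A assume A: "A \<in> sets (pre_sigma \<tau>)"
  have "A \<subseteq> space M" using sets.sets_into_space[OF A] by (simp add: space_pre_sigma)
  then have "{\<omega>\<in>A. \<tau> \<omega> \<le> T} = A" using \<tau>_le by auto
  then show "A \<in> sets M" using sets_pre_sigmaD[OF \<tau> A, of T] F_sub by auto
qed (simp add: space_pre_sigma)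

lemma simple_data_measurable:
  assumes D: "simple_data M F T (k, h0, \<tau>, h)"
  shows "i \<le> k \<Longrightarrow> \<tau> i \<in> borel_measurable M" "i < k \<Longrightarrow> h i \<in> borel_measurable M"
    "h0 \<in> borel_measurable M"
proof -
  show "\<tau> i \<in> borel_measurable M" if "i \<le> k"
    using D that by (intro measurable_stopping_time[of F]) (auto simp: F_sub[THEN subsetD] space_F)
  show "h0 \<in> borel_measurable M"
    by (rule measurable_from_subalg[OF subalgebra_F[of 0]]) (use D in simp)
  show "h i \<in> borel_measurable M" if "i < k"
    by (rule measurable_from_subalg[OF subalgebra_pre_sigma[of "\<tau> i"]]) (use D that in auto)
qed

lemma simple_process_measurable:
  assumes "simple_data M F T D"
  shows "simple_process D t \<in> borel_measurable M"
proof (cases D)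
  case (fields k h0 \<tau> h)
  note meas = simple_data_measurable[OF assms[unfolded fields]]
  have "(\<lambda>\<omega>. indicator {\<tau> i \<omega><..\<tau> (Suc i) \<omega>} t :: real) \<in> borel_measurable M" if "i < k" for i
  proof -
    have [measurable]: "\<tau> i \<in> borel_measurable M" "\<tau> (Suc i) \<in> borel_measurable M"
      using meas(1) that by auto
    show ?thesis unfolding indicator_def greaterThanAtMost_iff by measurable
  qed
  then show ?thesis unfolding fields simple_process.simps
    using meas by (intro borel_measurable_add borel_measurable_times borel_measurable_sum) auto
qed

lemma simple_integral_measurable:
  assumes D: "simple_data M F T D" and X: "X \<in> CL M F T" and t: "t \<in> {0..T}"
  shows "simple_integral D X t \<in> borel_measurable M"
proof (cases D)
  case (fields k h0 \<tau> h)
  note meas = simple_data_measurable[OF D[unfolded fields]]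
  have "(\<lambda>\<omega>. X (min (\<tau> i \<omega>) t) \<omega>) \<in> borel_measurable M" if "i \<le> k" for i
  proof (rule measurable_CL_at_random_time[OF X])
    show "(\<lambda>\<omega>. min (\<tau> i \<omega>) t) \<in> borel_measurable M" using meas(1)[OF that] by simp
    show "min (\<tau> i \<omega>) t \<in> {0..T}" if "\<omega> \<in> space M" for \<omega>
      using D that \<open>i \<le> k\<close> t by (auto simp: fields min_le_iff_disj)
  qed
  then show ?thesis unfolding fields simple_integral.simps
    using meas by (intro borel_measurable_diff borel_measurable_times borel_measurable_sum) auto
qed

lemma simple_integral_tendsto_at_left:
  assumes D: "simple_data M F T D" and X: "X \<in> CL M F T" and t: "t \<in> {0<..T}" and \<omega>: "\<omega> \<in> space M"
  shows "((\<lambda>s. simple_integral D X s \<omega>) \<longlongrightarrow>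
    simple_integral D X t \<omega> - simple_process D t \<omega> * jump X t \<omega>) (at_left t)"
proof (cases D)
  case (fields k h0 \<tau> h)
  let ?X = "\<lambda>i. X (min (\<tau> i \<omega>) t) \<omega>" and ?I = "\<lambda>i. indicator {..\<tau> i \<omega>} t * jump X t \<omega>"
  have "((\<lambda>s. simple_integral D X s \<omega>) \<longlongrightarrow>
      (\<Sum>i<k. h i \<omega> * ((?X (Suc i) - ?I (Suc i)) - (?X i - ?I i)))) (at_left t)"
    unfolding fields simple_integral.simps
    by (intro tendsto_intros tendsto_stopped_at_left[where T=T and X=X and \<omega>=\<omega>]
        CL_cadlag_path X \<omega> t)
  also have "(\<Sum>i<k. h i \<omega> * ((?X (Suc i) - ?I (Suc i)) - (?X i - ?I i))) =
     (\<Sum>i<k. h i \<omega> * (?X (Suc i) - ?X i) - h i \<omega> * indicator {\<tau> i \<omega><..\<tau> (Suc i) \<omega>} t * jump X t \<omega>)"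
  proof (intro sum.cong refl)
    fix i assume "i \<in> {..<k}"
    then have "\<tau> i \<omega> \<le> \<tau> (Suc i) \<omega>" using D \<omega> by (auto simp: fields)
    then show "h i \<omega> * ((?X (Suc i) - ?I (Suc i)) - (?X i - ?I i)) =
        h i \<omega> * (?X (Suc i) - ?X i) - h i \<omega> * indicator {\<tau> i \<omega><..\<tau> (Suc i) \<omega>} t * jump X t \<omega>"
      by (auto simp: indicator_def algebra_simps)
  qed
  also have "\<dots> = simple_integral D X t \<omega> - simple_process D t \<omega> * jump X t \<omega>"
    using t by (simp add: fields sum_subtractf sum_distrib_right del: sum_mult_indicator)
  finally show ?thesis .
qed

lemma jump_simple_integral:
  assumes "simple_data M F T D" "X \<in> CL M F T" "t \<in> {0<..T}" "\<omega> \<in> space M"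
  shows "jump (simple_integral D X) t \<omega> = simple_process D t \<omega> * jump X t \<omega>"
  using assms(3) jump_eqI[where X="simple_integral D X" and \<omega>=\<omega>,
      OF simple_integral_tendsto_at_left[OF assms]]
  by simp

lemma cadlag_path_simple_integral:
  assumes D: "simple_data M F T D" and X: "X \<in> CL M F T" and \<omega>: "\<omega> \<in> space M"
  shows "cadlag_path T (\<lambda>t. simple_integral D X t \<omega>)"
proof -
  have "((\<lambda>s. simple_integral D X s \<omega>) \<longlongrightarrow> simple_integral D X t \<omega>) (at_right t)"
    if "t \<in> {0..<T}" for t
  proof (cases D)
    case (fields k h0 \<tau> h)
    show ?thesis unfolding fields simple_integral.simps
      by (intro tendsto_intros tendsto_stopped_at_right[where T=T and f="\<lambda>t. X t \<omega>"]
          CL_cadlag_path X \<omega> that)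
  qed
  then show ?thesis
    using simple_integral_tendsto_at_left[OF D X _ \<omega>] unfolding cadlag_path_def by blast
qed

text \<open>For a fixed \<open>e\<close> the exceptional set is contained in those of all \<open>k\<close>, hence null; no almost
  surely convergent subsequence is needed.\<close>

lemma AE_uniformly_close_of_ucp_lim:
  fixes X Y :: "'a process"
  assumes X: "ucp_lim M T Xs X" "\<And>k. {\<omega>\<in>space M. \<exists>t\<in>{0..T}. e < \<bar>Xs k t \<omega> - X t \<omega>\<bar>} \<in> sets M"
    and Y: "ucp_lim M T Ys Y" "\<And>k. {\<omega>\<in>space M. \<exists>t\<in>{0..T}. e < \<bar>Ys k t \<omega> - Y t \<omega>\<bar>} \<in> sets M"
    and e: "0 < e"
  shows "AE \<omega> in M. \<exists>k. \<forall>t\<in>{0..T}. \<bar>Xs k t \<omega> - X t \<omega>\<bar> \<le> e \<and> \<bar>Ys k t \<omega> - Y t \<omega>\<bar> \<le> e"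
proof -
  define U where "U k = {\<omega>\<in>space M. \<exists>t\<in>{0..T}. e < \<bar>Xs k t \<omega> - X t \<omega>\<bar>}" for k
  define V where "V k = {\<omega>\<in>space M. \<exists>t\<in>{0..T}. e < \<bar>Ys k t \<omega> - Y t \<omega>\<bar>}" for k
  have sets: "U k \<in> sets M" "V k \<in> sets M" for k using X(2) Y(2) by (simp_all add: U_def V_def)
  define N where "N = (\<Inter>k. U k \<union> V k)"
  have N: "N \<in> sets M" using sets by (auto simp: N_def)
  have "measure M N \<le> measure M (U k) + measure M (V k)" for k
  proof -
    have "measure M N \<le> measure M (U k \<union> V k)"
      using sets by (intro finite_measure_mono) (auto simp: N_def)
    also have "\<dots> \<le> measure M (U k) + measure M (V k)" using sets by (rule measure_Un_le)
    finally show ?thesis .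
  qed
  moreover have "(\<lambda>k. measure M (U k) + measure M (V k)) \<longlonglongrightarrow> 0 + 0"
    using X(1) Y(1) e unfolding ucp_lim_def U_def V_def by (intro tendsto_add) auto
  ultimately have "measure M N \<le> 0 + 0"
    by (intro LIMSEQ_le_const[where X="\<lambda>k. measure M (U k) + measure M (V k)"]) auto
  then have "N \<in> null_sets M"
    using N by (simp add: null_sets_def emeasure_eq_measure measure_le_0_iff)
  then have "AE \<omega> in M. \<omega> \<notin> N" by (rule AE_not_in)
  with AE_space show ?thesis
    by eventually_elim (auto simp: N_def U_def V_def not_less)
qed

lemma sets_simple_process_exceedance:
  assumes D: "simple_data M F T D" and H: "adapted F T H"
    and H_caglad: "\<And>\<omega>. \<omega> \<in> space M \<Longrightarrow> caglad_path T (\<lambda>t. H t \<omega>)"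
  shows "{\<omega>\<in>space M. \<exists>t\<in>{0..T}. e < \<bar>simple_process D t \<omega> - H t \<omega>\<bar>} \<in> sets M"
proof (rule sets_exceedance)
  fix t assume "t \<in> {0..T}"
  then have "H t \<in> borel_measurable (F t)" using H by (simp add: adapted_def)
  then show "(\<lambda>\<omega>. simple_process D t \<omega> - H t \<omega>) \<in> borel_measurable M"
    using simple_process_measurable[OF D] measurable_from_subalg[OF subalgebra_F]
    by (intro borel_measurable_diff)
next
  fix \<omega> t assume \<omega>: "\<omega> \<in> space M" and t: "t \<in> {0<..<T}"
  then have "((\<lambda>s. H s \<omega>) \<longlongrightarrow> H t \<omega>) (at_left t)"
    using H_caglad[OF \<omega>] by (auto simp: caglad_path_def)
  then have "((\<lambda>s. simple_process D s \<omega> - H s \<omega>) \<longlongrightarrow> simple_process D t \<omega> - H t \<omega>) (at_left t)"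
    using t by (intro tendsto_diff simple_process_left_continuous) auto
  then show "((\<lambda>s. simple_process D s \<omega> - H s \<omega>) \<longlongrightarrow> simple_process D t \<omega> - H t \<omega>) (at_left t) \<or>
      ((\<lambda>s. simple_process D s \<omega> - H s \<omega>) \<longlongrightarrow> simple_process D t \<omega> - H t \<omega>) (at_right t)" ..
qed

lemma sets_simple_integral_exceedance:
  assumes D: "simple_data M F T D" and X: "X \<in> CL M F T" and I: "I \<in> CL M F T"
  shows "{\<omega>\<in>space M. \<exists>t\<in>{0..T}. e < \<bar>simple_integral D X t \<omega> - I t \<omega>\<bar>} \<in> sets M"
proof (rule sets_exceedance)
  show "(\<lambda>\<omega>. simple_integral D X t \<omega> - I t \<omega>) \<in> borel_measurable M" if "t \<in> {0..T}" for t
    by (intro borel_measurable_diff simple_integral_measurable[OF D X that]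
        CL_measurable[OF I that])
next
  fix \<omega> t assume \<omega>: "\<omega> \<in> space M" and "t \<in> {0<..<T}"
  then have t: "t \<in> {0..<T}" by auto
  have "((\<lambda>s. simple_integral D X s \<omega> - I s \<omega>) \<longlongrightarrow> simple_integral D X t \<omega> - I t \<omega>) (at_right t)"
    by (intro tendsto_diff cadlag_path_tendsto_at_right[OF cadlag_path_simple_integral[OF D X \<omega>] t]
        cadlag_path_tendsto_at_right[OF CL_cadlag_path[OF I \<omega>] t])
  then show "((\<lambda>s. simple_integral D X s \<omega> - I s \<omega>) \<longlongrightarrow> simple_integral D X t \<omega> - I t \<omega>) (at_left t) \<or>
      ((\<lambda>s. simple_integral D X s \<omega> - I s \<omega>) \<longlongrightarrow> simple_integral D X t \<omega> - I t \<omega>) (at_right t)" ..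
qed

lemma stochastic_integral_approximable:
  assumes I: "stochastic_integral M F T H X I" and e: "0 < e"
  shows "AE \<omega> in M. \<exists>D. simple_data M F T D \<and>
    (\<forall>t\<in>{0..T}. \<bar>simple_process D t \<omega> - H t \<omega>\<bar> \<le> e \<and> \<bar>simple_integral D X t \<omega> - I t \<omega>\<bar> \<le> e)"
proof -
  obtain D where D: "\<And>k. simple_data M F T (D k)"
    and lim: "ucp_lim M T (\<lambda>k. simple_process (D k)) H"
      "ucp_lim M T (\<lambda>k. simple_integral (D k) X) I"
    using I unfolding stochastic_integral_def by blast
  have "AE \<omega> in M. \<exists>k. \<forall>t\<in>{0..T}.
      \<bar>simple_process (D k) t \<omega> - H t \<omega>\<bar> \<le> e \<and> \<bar>simple_integral (D k) X t \<omega> - I t \<omega>\<bar> \<le> e"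
    using I D by (intro AE_uniformly_close_of_ucp_lim lim e sets_simple_process_exceedance
        sets_simple_integral_exceedance) (auto simp: stochastic_integral_def semimartingale_def)
  then show ?thesis by eventually_elim (use D in blast)
qed

lemma jump_error_of_simple_integral:
  assumes D: "simple_data M F T D" and X: "X \<in> CL M F T" and I: "I \<in> CL M F T"
    and \<omega>: "\<omega> \<in> space M" and t: "t \<in> {0<..T}"
    and H: "\<bar>simple_process D t \<omega> - H t \<omega>\<bar> \<le> e"
    and close: "\<And>s. s \<in> {0..T} \<Longrightarrow> \<bar>simple_integral D X s \<omega> - I s \<omega>\<bar> \<le> e"
  shows "\<bar>jump I t \<omega> - H t \<omega> * jump X t \<omega>\<bar> \<le> (2 + \<bar>jump X t \<omega>\<bar>) * e"
proof -
  have "\<bar>jump (simple_integral D X) t \<omega> - jump I t \<omega>\<bar> \<le> 2 * e"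
    by (intro cadlag_path_jump_diff_le[where T=T] cadlag_path_simple_integral[OF D] CL_cadlag_path
        X I \<omega> t close)
  moreover have "\<bar>simple_process D t \<omega> * jump X t \<omega> - H t \<omega> * jump X t \<omega>\<bar> \<le> e * \<bar>jump X t \<omega>\<bar>"
    using mult_right_mono[OF H, of "\<bar>jump X t \<omega>\<bar>"]
    by (simp add: abs_mult[symmetric] left_diff_distrib)
  ultimately have "\<bar>jump I t \<omega> - H t \<omega> * jump X t \<omega>\<bar> \<le> 2 * e + e * \<bar>jump X t \<omega>\<bar>"
    unfolding jump_simple_integral[OF D X t \<omega>] by linarith
  then show ?thesis by (simp add: algebra_simps)
qed

lemma jump_stochastic_integral:
  assumes I: "stochastic_integral M F T H X I"
  shows "AE \<omega> in M. \<forall>t\<in>{0<..T}. jump I t \<omega> = H t \<omega> * jump X t \<omega>"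
proof -
  have CL: "X \<in> CL M F T" "I \<in> CL M F T"
    using I by (auto simp: stochastic_integral_def semimartingale_def)
  have "AE \<omega> in M. \<forall>j::nat. \<exists>D. simple_data M F T D \<and>
    (\<forall>t\<in>{0..T}. \<bar>simple_process D t \<omega> - H t \<omega>\<bar> \<le> inverse (Suc j) \<and>
                \<bar>simple_integral D X t \<omega> - I t \<omega>\<bar> \<le> inverse (Suc j))"
    using stochastic_integral_approximable[OF I] by (subst AE_all_countable) simp
  with AE_space show ?thesis
  proof (eventually_elim, intro ballI)
    case (elim \<omega>)
    fix t assume t: "t \<in> {0<..T}"
    have "\<bar>jump I t \<omega> - H t \<omega> * jump X t \<omega>\<bar> \<le> (2 + \<bar>jump X t \<omega>\<bar>) * inverse (Suc j)" for j :: nat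
    proof -
      obtain D where "simple_data M F T D"
        "\<And>s. s \<in> {0..T} \<Longrightarrow> \<bar>simple_process D s \<omega> - H s \<omega>\<bar> \<le> inverse (Suc j)"
        "\<And>s. s \<in> {0..T} \<Longrightarrow> \<bar>simple_integral D X s \<omega> - I s \<omega>\<bar> \<le> inverse (Suc j)"
        using elim(2) by blast
      then show ?thesis using t by (intro jump_error_of_simple_integral CL elim(1)) auto
    qed
    moreover have "(\<lambda>j. (2 + \<bar>jump X t \<omega>\<bar>) * inverse (Suc j)) \<longlonglongrightarrow> (2 + \<bar>jump X t \<omega>\<bar>) * 0"
      using LIMSEQ_inverse_real_of_nat by (intro tendsto_mult tendsto_const)
    ultimately have "\<bar>jump I t \<omega> - H t \<omega> * jump X t \<omega>\<bar> \<le> (2 + \<bar>jump X t \<omega>\<bar>) * 0"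
      by (intro LIMSEQ_le_const[where X="\<lambda>j. (2 + \<bar>jump X t \<omega>\<bar>) * inverse (Suc j)"]) auto
    then show "jump I t \<omega> = H t \<omega> * jump X t \<omega>" by simp
  qed
qed

end


section \<open>Moments of jump counts\<close>

definition big_marks :: "real \<Rightarrow> (real \<Rightarrow> real) \<Rightarrow> (real \<times> real) set" where
  "big_marks T g = {p \<in> {0..T} \<times> UNIV. g (fst p) < \<bar>snd p\<bar>}"

lemma sets_big_marks:
  assumes "continuous_on {0..T} g"
  shows "big_marks T g \<in> sets (time_mark_space T)"
proof -
  have g: "g \<in> borel_measurable (restrict_space borel {0..T})"
    using assms by (rule borel_measurable_continuous_on_restrict)
  have "{p \<in> space (time_mark_space T). g (fst p) < \<bar>snd p\<bar>} \<in> sets (time_mark_space T)"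
    unfolding time_mark_space_def using g by measurable
  then show ?thesis
    by (simp add: big_marks_def time_mark_space_def space_pair_measure space_restrict_space)
qed

lemma nn_integral_jump_measure_big_marks:
  assumes g: "continuous_on {0..T} g" "\<And>t. t \<in> {0..T} \<Longrightarrow> 0 \<le> g t"
    and h: "h \<in> borel_measurable (restrict_space borel {0..T})"
  shows "(\<integral>\<^sup>+ p. h (fst p) * indicator (big_marks T g) p \<partial>jump_measure T X \<omega>) =
    (\<integral>\<^sup>+ s. h s \<partial>count_space (jump_times T X g \<omega>))"
proof -
  let ?D = "{s\<in>{0<..T}. jump X s \<omega> \<noteq> 0}"
  have embed: "(\<lambda>s. (s, jump X s \<omega>)) \<in> count_space ?D \<rightarrow>\<^sub>M time_mark_space T"
    by (auto simp: time_mark_space_def space_pair_measure space_restrict_space)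
  have integrand: "(\<lambda>p. h (fst p) * indicator (big_marks T g) p) \<in>
      borel_measurable (time_mark_space T)"
  proof (intro borel_measurable_times_ennreal borel_measurable_indicator sets_big_marks g)
    show "(\<lambda>p. h (fst p)) \<in> borel_measurable (time_mark_space T)"
      unfolding time_mark_space_def using h by measurable
  qed
  have sub: "jump_times T X g \<omega> \<subseteq> ?D"
  proof
    fix s assume s: "s \<in> jump_times T X g \<omega>"
    then have "0 \<le> g s" by (intro g(2)) (auto simp: jump_times_def)
    then show "s \<in> ?D" using s by (auto simp: jump_times_def)
  qed
  have "(\<integral>\<^sup>+ p. h (fst p) * indicator (big_marks T g) p \<partial>jump_measure T X \<omega>) =
    (\<integral>\<^sup>+ s. h s * indicator (big_marks T g) (s, jump X s \<omega>) \<partial>count_space ?D)"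
    unfolding jump_measure_def using integrand by (subst nn_integral_distr[OF embed]) simp_all
  also have "\<dots> = (\<integral>\<^sup>+ s. h s * indicator (jump_times T X g \<omega>) s \<partial>count_space ?D)"
    by (intro nn_integral_cong arg_cong2[where f="(*)"] refl)
      (auto simp: indicator_def big_marks_def jump_times_def)
  also have "\<dots> = (\<integral>\<^sup>+ s. h s \<partial>count_space (jump_times T X g \<omega>))"
    using sub by (subst (1 2) nn_integral_count_space_indicator)
      (auto intro!: nn_integral_cong simp: indicator_def)
  finally show ?thesis .
qed

lemma square_add_le_ennreal:
  fixes x y :: ennreal
  shows "(x + y)\<^sup>2 \<le> 2 * (x\<^sup>2 + y\<^sup>2)"
proof (cases x; cases y)
  fix a b assume xy: "x = ennreal a" "y = ennreal b" "0 \<le> a" "0 \<le> b"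
  have "(a + b)\<^sup>2 \<le> 2 * (a\<^sup>2 + b\<^sup>2)"
    using sum_squares_bound[of a b] by (simp add: power2_eq_square algebra_simps)
  then have "ennreal ((a + b)\<^sup>2) \<le> ennreal (2 * (a\<^sup>2 + b\<^sup>2))" by (rule ennreal_leI)
  moreover have "ennreal ((a + b)\<^sup>2) = (x + y)\<^sup>2" using xy by (simp add: ennreal_power[symmetric])
  moreover have "ennreal (2 * (a\<^sup>2 + b\<^sup>2)) = 2 * (x\<^sup>2 + y\<^sup>2)"
    using xy by (simp add: ennreal_power ennreal_mult')
  ultimately show ?thesis by simp
qed (simp_all add: power_top_ennreal ennreal_mult_top)

context filtered_prob_space
begin

lemma predictable_generators_subset:
  "{A \<times> {0} | A. A \<in> sets (F 0)} \<union>
   {A \<times> {s<..t} | A s t. 0 \<le> s \<and> s < t \<and> t \<le> T \<and> A \<in> sets (F s)} \<subseteq> Pow (space M \<times> {0..T})"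
proof -
  have "A \<subseteq> space M" if "A \<in> sets (F s)" for A s
    using sets.sets_into_space[OF that] by (simp add: space_F)
  then show ?thesis using T_pos by fastforce
qed

lemma space_predictable_sigma: "space (predictable_sigma M F T) = space M \<times> {0..T}"
  unfolding predictable_sigma_def by (rule space_measure_of[OF predictable_generators_subset])

lemma predictable_rectangle:
  assumes "0 \<le> s" "s < T" "A \<in> sets (F s)"
  shows "A \<times> {s<..T} \<in> sets (predictable_sigma M F T)"
  unfolding predictable_sigma_def sets_measure_of[OF predictable_generators_subset]
  using assms by (intro sigma_sets.Basic UnI2) blast

lemma measurable_Pair_predictable_sigma:
  assumes "\<omega> \<in> space M"
  shows "Pair \<omega> \<in> restrict_space borel {0..T} \<rightarrow>\<^sub>M predictable_sigma M F T"
  unfolding predictable_sigma_def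
proof (rule measurable_measure_of[OF predictable_generators_subset])
  show "Pair \<omega> \<in> space (restrict_space borel {0..T}) \<rightarrow> space M \<times> {0..T}"
    using assms by (simp add: space_restrict_space)
  fix E assume E: "E \<in> {A \<times> {0} | A. A \<in> sets (F 0)} \<union>
    {A \<times> {s<..t} | A s t. 0 \<le> s \<and> s < t \<and> t \<le> T \<and> A \<in> sets (F s)}"
  then obtain A I where AI: "E = A \<times> I" "I = {0} \<or> (\<exists>s t. I = {s<..t})" by blast
  then have "I \<in> sets borel" by auto
  moreover have "Pair \<omega> -` E \<inter> space (restrict_space borel {0..T}) =
      (if \<omega> \<in> A then I \<inter> {0..T} else {})"
    using AI by (auto simp: space_restrict_space)
  ultimately show "Pair \<omega> -` E \<inter> space (restrict_space borel {0..T}) \<in>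
      sets (restrict_space borel {0..T})"
    by (auto simp: sets_restrict_space_iff)
qed

lemma measurable_snd_predictable_sigma:
  "snd \<in> predictable_sigma M F T \<rightarrow>\<^sub>M restrict_space borel {0..T}"
proof (rule measurable_restrict_space2)
  show "snd \<in> space (predictable_sigma M F T) \<rightarrow> {0..T}" by (auto simp: space_predictable_sigma)
  show "snd \<in> borel_measurable (predictable_sigma M F T)"
  proof (rule borel_measurableI_greater)
    fix y :: real
    consider (before) "y < 0" | (after) "T \<le> y" | (inside) "0 \<le> y" "y < T" by linarith
    then show "{x \<in> space (predictable_sigma M F T). y < snd x} \<in> sets (predictable_sigma M F T)"
    proof cases
      case before
      then have "{x \<in> space (predictable_sigma M F T). y < snd x} = space (predictable_sigma M F T)"
        by (auto simp: space_predictable_sigma)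
      then show ?thesis by simp
    next
      case after
      then have "{x \<in> space (predictable_sigma M F T). y < snd x} = {}"
        by (auto simp: space_predictable_sigma)
      then show ?thesis by (simp only: sets.empty_sets)
    next
      case inside
      then have "{x \<in> space (predictable_sigma M F T). y < snd x} = space (F y) \<times> {y<..T}"
        by (auto simp: space_predictable_sigma space_F)
      then show ?thesis using predictable_rectangle[OF inside sets.top] by simp
    qed
  qed
qed

lemma measurable_predictable_step:
  fixes f :: "'a \<Rightarrow> ennreal"
  assumes f: "f \<in> borel_measurable (F s)" and s: "0 \<le> s" "s < T"
  shows "(\<lambda>x. f (fst x) * indicator {s<..T} (snd x)) \<in> borel_measurable (predictable_sigma M F T)"
proof (rule borel_measurableI_greater)
  fix y :: ennreal
  have "{\<omega>\<in>space (F s). y < f \<omega>} \<in> sets (F s)" using f by measurable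
  moreover have "{x \<in> space (predictable_sigma M F T). y < f (fst x) * indicator {s<..T} (snd x)}
     = {\<omega>\<in>space (F s). y < f \<omega>} \<times> {s<..T}"
    using s by (auto simp: space_predictable_sigma space_F indicator_def split: if_splits)
  ultimately show "{x \<in> space (predictable_sigma M F T). y < f (fst x) * indicator {s<..T} (snd x)}
      \<in> sets (predictable_sigma M F T)"
    using predictable_rectangle[OF s] by simp
qed

lemma measurable_past_jump_count:
  assumes X: "X \<in> CL M F T" and g: "continuous_on {0..T} g"
  shows "(\<lambda>x. ecard (jump_times T X g (fst x) \<inter> {..<snd x})) \<in>
      borel_measurable (predictable_sigma M F T)"
proof -
  define N where "N q \<omega> = ecard (jump_times T X g \<omega> \<inter> {..q})" for q \<omega>
  have "ecard (jump_times T X g \<omega> \<inter> {..<s}) = (SUP q\<in>\<rat> \<inter> {0<..<T}. N q \<omega> * indicator {q<..T} s)"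
    if "s \<in> {0..T}" for \<omega> s
  proof -
    have "ecard (jump_times T X g \<omega> \<inter> {..<s}) = (SUP q\<in>\<rat> \<inter> {0<..<s}. N q \<omega>)"
      unfolding N_def by (rule ecard_lessThan_eq_SUP) (auto simp: jump_times_def)
    also have "\<dots> = (SUP q\<in>\<rat> \<inter> {0<..<T}. N q \<omega> * indicator {q<..T} s)"
    proof (rule antisym)
      show "(SUP q\<in>\<rat> \<inter> {0<..<s}. N q \<omega>) \<le> (SUP q\<in>\<rat> \<inter> {0<..<T}. N q \<omega> * indicator {q<..T} s)"
        using that by (intro SUP_mono) (auto simp: indicator_def)
      show "(SUP q\<in>\<rat> \<inter> {0<..<T}. N q \<omega> * indicator {q<..T} s) \<le> (SUP q\<in>\<rat> \<inter> {0<..<s}. N q \<omega>)"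
        by (intro SUP_least) (auto simp: indicator_def intro: SUP_upper)
    qed
    finally show ?thesis .
  qed
  moreover have "(\<lambda>x. SUP q\<in>\<rat> \<inter> {0<..<T}. N q (fst x) * indicator {q<..T} (snd x))
      \<in> borel_measurable (predictable_sigma M F T)"
    unfolding N_def using measurable_ecard_jump_times[OF X g]
    by (intro borel_measurable_SUP measurable_predictable_step countable_Int1 countable_rat) auto
  ultimately show ?thesis
    by (subst measurable_cong) (auto simp: space_predictable_sigma)
qed

lemma nn_integral_jump_times_compensator:
  assumes comp: "is_compensator M F T (jump_measure T X) \<pi>"
    and g: "continuous_on {0..T} g" "\<And>t. t \<in> {0..T} \<Longrightarrow> 0 \<le> g t"
    and h: "h \<in> borel_measurable (predictable_sigma M F T)"
  shows "(\<integral>\<^sup>+ \<omega>. (\<integral>\<^sup>+ s. h (\<omega>, s) \<partial>count_space (jump_times T X g \<omega>)) \<partial>M) =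
     (\<integral>\<^sup>+ \<omega>. (\<integral>\<^sup>+ p. h (\<omega>, fst p) * indicator (big_marks T g) p \<partial>\<pi> \<omega>) \<partial>M)"
proof -
  define W where "W x = h (fst x) * indicator (big_marks T g) (snd (fst x), snd x)" for x
  have "(\<lambda>x. (snd (fst x), snd x)) \<in> predictable_sigma M F T \<Otimes>\<^sub>M borel \<rightarrow>\<^sub>M time_mark_space T"
    unfolding time_mark_space_def
    by (intro measurable_Pair measurable_compose[OF measurable_fst measurable_snd_predictable_sigma]
        measurable_snd)
  then have "(\<lambda>x. indicator (big_marks T g) (snd (fst x), snd x) :: ennreal)
      \<in> borel_measurable (predictable_sigma M F T \<Otimes>\<^sub>M borel)"
    using sets_big_marks[OF g(1)] by (intro measurable_compose[OF _ borel_measurable_indicator])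
  then have "W \<in> predictable_fun M F T"
    unfolding predictable_fun_def W_def using h
    by (intro borel_measurable_times_ennreal measurable_compose[OF measurable_fst])
  then have "(\<integral>\<^sup>+ \<omega>. (\<integral>\<^sup>+ (s, z). W ((\<omega>, s), z) \<partial>jump_measure T X \<omega>) \<partial>M) =
      (\<integral>\<^sup>+ \<omega>. (\<integral>\<^sup>+ (s, z). W ((\<omega>, s), z) \<partial>\<pi> \<omega>) \<partial>M)"
    using comp unfolding is_compensator_def by blast
  moreover have "(\<integral>\<^sup>+ (s, z). W ((\<omega>, s), z) \<partial>jump_measure T X \<omega>) =
      (\<integral>\<^sup>+ s. h (\<omega>, s) \<partial>count_space (jump_times T X g \<omega>))" if "\<omega> \<in> space M" for \<omega>
    using nn_integral_jump_measure_big_marks[OF g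
        measurable_compose[OF measurable_Pair_predictable_sigma[OF that] h]]
    by (simp add: W_def case_prod_beta')
  ultimately show ?thesis by (simp add: W_def case_prod_beta' cong: nn_integral_cong)
qed

lemma measurable_ecard_Un_jump_times:
  assumes X: "X \<in> CL M F T" and g: "continuous_on {0..T} g"
  shows "(\<lambda>\<omega>. ecard (B \<union> jump_times T X g \<omega>)) \<in> borel_measurable M"
proof (rule borel_measurable_ecard)
  fix c d :: real
  have "jump_times T X g \<omega> \<inter> {..T} = jump_times T X g \<omega>" for \<omega> by (auto simp: jump_times_def)
  then have "{\<omega>\<in>space M. jump_times T X g \<omega> \<inter> {c<..d} \<noteq> {}} \<in> sets M"
    using sets_jump_times_atMost_hit[OF X g order_refl, of c d] F_sub by auto
  then have "{\<omega>\<in>space M. B \<inter> {c<..d} \<noteq> {} \<or> jump_times T X g \<omega> \<inter> {c<..d} \<noteq> {}} \<in> sets M"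
    by (intro sets.sets_Collect_disj sets.sets_Collect_const)
  then show "{\<omega>\<in>space M. (B \<union> jump_times T X g \<omega>) \<inter> {c<..d} \<noteq> {}} \<in> sets M"
    by (simp add: Int_Un_distrib2)
qed

lemma sets_big_marks_compensator:
  assumes "is_compensator M F T \<mu> \<pi>" "continuous_on {0..T} g" "\<omega> \<in> space M"
  shows "big_marks T g \<in> sets (\<pi> \<omega>)"
  using assms sets_big_marks[of T g]
  by (simp add: is_compensator_def predictable_random_measure_def random_measure_def)

lemma jump_count_first_moment:
  assumes comp: "is_compensator M F T (jump_measure T X) \<pi>"
    and g: "continuous_on {0..T} g" "\<And>t. t \<in> {0..T} \<Longrightarrow> 0 \<le> g t"
    and K: "AE \<omega> in M. emeasure (\<pi> \<omega>) (big_marks T g) \<le> K"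
  shows "(\<integral>\<^sup>+ \<omega>. ecard (jump_times T X g \<omega>) \<partial>M) \<le> K"
proof -
  have "(\<integral>\<^sup>+ \<omega>. ecard (jump_times T X g \<omega>) \<partial>M) =
      (\<integral>\<^sup>+ \<omega>. (\<integral>\<^sup>+ p. 1 * indicator (big_marks T g) p \<partial>\<pi> \<omega>) \<partial>M)"
    unfolding ecard_conv_nn_integral
    by (rule nn_integral_jump_times_compensator[OF comp g borel_measurable_const])
  also have "\<dots> = (\<integral>\<^sup>+ \<omega>. emeasure (\<pi> \<omega>) (big_marks T g) \<partial>M)"
    using sets_big_marks_compensator[OF comp g(1)] by (intro nn_integral_cong) simp
  also have "\<dots> \<le> (\<integral>\<^sup>+ \<omega>. K \<partial>M)" using K by (rule nn_integral_mono_AE)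
  finally show ?thesis by (simp add: emeasure_space_1)
qed

lemma jump_count_second_moment:
  assumes X: "X \<in> CL M F T" and comp: "is_compensator M F T (jump_measure T X) \<pi>"
    and g: "continuous_on {0..T} g" "\<And>t. t \<in> {0..T} \<Longrightarrow> 0 \<le> g t"
    and K: "AE \<omega> in M. emeasure (\<pi> \<omega>) (big_marks T g) \<le> K"
  shows "(\<integral>\<^sup>+ \<omega>. (ecard (jump_times T X g \<omega>))\<^sup>2 \<partial>M) \<le> (2 * K + 1) * K"
proof -
  define N where "N \<omega> = ecard (jump_times T X g \<omega>)" for \<omega>
  have N[measurable]: "N \<in> borel_measurable M"
    using measurable_ecard_Un_jump_times[OF X g(1), of "{}"] by (simp add: N_def[abs_def])
  define h where "h x = 2 * ecard (jump_times T X g (fst x) \<inter> {..<snd x}) + 1" for x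
  have h_le: "h (\<omega>, s) \<le> 2 * N \<omega> + 1" for \<omega> s
    unfolding h_def N_def by (auto intro!: add_right_mono mult_left_mono emeasure_mono)
  have "(\<integral>\<^sup>+ \<omega>. (N \<omega>)\<^sup>2 \<partial>M) = (\<integral>\<^sup>+ \<omega>. (\<integral>\<^sup>+ s. h (\<omega>, s) \<partial>count_space (jump_times T X g \<omega>)) \<partial>M)"
    unfolding N_def h_def fst_conv snd_conv ecard_square_eq_nn_integral ..
  also have "\<dots> = (\<integral>\<^sup>+ \<omega>. (\<integral>\<^sup>+ p. h (\<omega>, fst p) * indicator (big_marks T g) p \<partial>\<pi> \<omega>) \<partial>M)"
    unfolding h_def using measurable_past_jump_count[OF X g(1)]
    by (intro nn_integral_jump_times_compensator[OF comp g] borel_measurable_add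
        borel_measurable_times_ennreal borel_measurable_const)
  also have "\<dots> \<le> (\<integral>\<^sup>+ \<omega>. (2 * N \<omega> + 1) * K \<partial>M)"
  proof (rule nn_integral_mono_AE, use K AE_space in eventually_elim)
    case (elim \<omega>)
    have "(\<integral>\<^sup>+ p. h (\<omega>, fst p) * indicator (big_marks T g) p \<partial>\<pi> \<omega>) \<le>
        (\<integral>\<^sup>+ p. (2 * N \<omega> + 1) * indicator (big_marks T g) p \<partial>\<pi> \<omega>)"
      using h_le by (intro nn_integral_mono mult_right_mono) auto
    also have "\<dots> = (2 * N \<omega> + 1) * emeasure (\<pi> \<omega>) (big_marks T g)"
      using sets_big_marks_compensator[OF comp g(1) elim(2)] by (rule nn_integral_cmult_indicator)
    also have "\<dots> \<le> (2 * N \<omega> + 1) * K" using elim(1) by (rule mult_left_mono) simp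
    finally show ?case .
  qed
  also have "\<dots> = (2 * (\<integral>\<^sup>+ \<omega>. N \<omega> \<partial>M) + 1) * K"
    by (simp add: nn_integral_multc nn_integral_add nn_integral_cmult emeasure_space_1)
  also have "\<dots> \<le> (2 * K + 1) * K"
    using jump_count_first_moment[OF comp g K]
    by (intro mult_right_mono add_right_mono mult_left_mono) (simp_all add: N_def)
  finally show ?thesis unfolding N_def .
qed

lemma AE_finite_jump_times:
  assumes X: "X \<in> CL M F T" and comp: "is_compensator M F T (jump_measure T X) \<pi>"
    and g: "continuous_on {0..T} g" "\<And>t. t \<in> {0..T} \<Longrightarrow> 0 \<le> g t"
    and K: "AE \<omega> in M. emeasure (\<pi> \<omega>) (big_marks T g) \<le> K" "K < \<infinity>"
  shows "AE \<omega> in M. finite (jump_times T X g \<omega>)"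
proof -
  have "AE \<omega> in M. ecard (jump_times T X g \<omega>) \<noteq> \<infinity>"
    using jump_count_first_moment[OF comp g K(1)] K(2)
      measurable_ecard_Un_jump_times[OF X g(1), of "{}"]
    by (intro nn_integral_PInf_AE) auto
  then show ?thesis by eventually_elim (simp add: emeasure_count_space split: if_splits)
qed

lemma ecard_Un_jump_times_second_moment:
  assumes X: "X \<in> CL M F T" and comp: "is_compensator M F T (jump_measure T X) \<pi>"
    and g: "continuous_on {0..T} g" "\<And>t. t \<in> {0..T} \<Longrightarrow> 0 \<le> g t"
    and K: "AE \<omega> in M. emeasure (\<pi> \<omega>) (big_marks T g) \<le> K"
  shows "(\<integral>\<^sup>+ \<omega>. (ecard (B \<union> jump_times T X g \<omega>))\<^sup>2 \<partial>M) \<le> 2 * ((ecard B)\<^sup>2 + (2 * K + 1) * K)"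
proof -
  have [measurable]: "(\<lambda>\<omega>. ecard (jump_times T X g \<omega>)) \<in> borel_measurable M"
    using measurable_ecard_Un_jump_times[OF X g(1), of "{}"] by simp
  have "ecard (B \<union> jump_times T X g \<omega>) \<le> ecard B + ecard (jump_times T X g \<omega>)" for \<omega>
    by (rule emeasure_subadditive) auto
  then have "(\<integral>\<^sup>+ \<omega>. (ecard (B \<union> jump_times T X g \<omega>))\<^sup>2 \<partial>M) \<le>
      (\<integral>\<^sup>+ \<omega>. 2 * ((ecard B)\<^sup>2 + (ecard (jump_times T X g \<omega>))\<^sup>2) \<partial>M)"
    by (intro nn_integral_mono order_trans[OF power_mono square_add_le_ennreal]) auto
  also have "\<dots> = 2 * ((ecard B)\<^sup>2 + (\<integral>\<^sup>+ \<omega>. (ecard (jump_times T X g \<omega>))\<^sup>2 \<partial>M))"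
    by (simp add: nn_integral_cmult nn_integral_add emeasure_space_1)
  also have "\<dots> \<le> 2 * ((ecard B)\<^sup>2 + (2 * K + 1) * K)"
    using jump_count_second_moment[OF X comp g K] by (intro mult_left_mono add_left_mono) auto
  finally show ?thesis .
qed

end


section \<open>Norms and change of measure\<close>

lemma ennpowr_ennreal: "0 \<le> x \<Longrightarrow> ennpowr (ennreal x) p = ennreal (x powr p)"
  by (simp add: ennpowr_def)

lemma ennpowr_mono: "x \<le> y \<Longrightarrow> 0 \<le> p \<Longrightarrow> ennpowr x p \<le> ennpowr y p"
  by (auto simp: ennpowr_def top_unique less_top intro!: ennreal_leI powr_mono2 enn2real_mono)

lemma ennpowr_mult: "ennpowr (x * y) p = ennpowr x p * ennpowr y p"
  by (cases x; cases y)
    (auto simp: ennpowr_def ennreal_mult_top ennreal_top_mult powr_mult ennreal_mult'[symmetric])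

lemma ennpowr_ennpowr: "ennpowr (ennpowr x p) r = ennpowr x (p * r)"
  by (simp add: ennpowr_def powr_powr)

lemma ennpowr_1: "ennpowr x 1 = x"
  by (cases x) (simp_all add: ennpowr_def)

lemma ennpowr_2: "ennpowr x 2 = x\<^sup>2"
  by (cases x) (simp_all add: ennpowr_def ennreal_power[symmetric] power_top_ennreal)

lemma ennpowr_eq_0_iff: "ennpowr x p = 0 \<longleftrightarrow> x = 0"
  by (cases x) (auto simp: ennpowr_def)

lemma ennpowr_eq_top_iff: "ennpowr x p = \<top> \<longleftrightarrow> x = \<top>"
  by (simp add: ennpowr_def)

lemma measurable_ennpowr [measurable]:
  assumes [measurable]: "f \<in> borel_measurable M"
  shows "(\<lambda>x. ennpowr (f x) p) \<in> borel_measurable M"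
  unfolding ennpowr_def by measurable

lemma Youngs_inequality_ennreal:
  assumes pq: "1 < p" "1 < q" "1 / p + 1 / q = 1"
  shows "x * y \<le> ennreal (1 / p) * ennpowr x p + ennreal (1 / q) * ennpowr y q"
proof (cases "x = \<infinity> \<or> y = \<infinity>")
  case True
  then have "ennreal (1 / p) * ennpowr x p + ennreal (1 / q) * ennpowr y q = \<infinity>"
    using pq by (auto simp: ennpowr_def ennreal_mult_top)
  then show ?thesis by (simp only: infinity_ennreal_def top_greatest)
next
  case False
  then obtain a b where ab: "x = ennreal a" "y = ennreal b" "0 \<le> a" "0 \<le> b"
    by (metis ennreal_cases infinity_ennreal_def)
  then have "a * b \<le> a powr p / p + b powr q / q" using pq by (intro Youngs_inequality) auto
  then have "ennreal (a * b) \<le> ennreal (a powr p / p + b powr q / q)" by (rule ennreal_leI)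
  then show ?thesis using ab pq by (simp add: ennpowr_ennreal ennreal_mult'[symmetric])
qed

lemma nn_integral_mult_le_1:
  assumes [measurable]: "f \<in> borel_measurable M" "g \<in> borel_measurable M"
    and pq: "1 < p" "1 < q" "1 / p + 1 / q = 1"
    and le_1: "(\<integral>\<^sup>+ x. ennpowr (f x) p \<partial>M) \<le> 1" "(\<integral>\<^sup>+ x. ennpowr (g x) q \<partial>M) \<le> 1"
  shows "(\<integral>\<^sup>+ x. f x * g x \<partial>M) \<le> 1"
proof -
  have "(\<integral>\<^sup>+ x. f x * g x \<partial>M) \<le>
      (\<integral>\<^sup>+ x. ennreal (1 / p) * ennpowr (f x) p + ennreal (1 / q) * ennpowr (g x) q \<partial>M)"
    by (intro nn_integral_mono Youngs_inequality_ennreal pq)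
  also have "\<dots> = ennreal (1 / p) * (\<integral>\<^sup>+ x. ennpowr (f x) p \<partial>M) +
      ennreal (1 / q) * (\<integral>\<^sup>+ x. ennpowr (g x) q \<partial>M)"
    by (simp add: nn_integral_add nn_integral_cmult)
  also have "\<dots> \<le> ennreal (1 / p) * 1 + ennreal (1 / q) * 1"
    using le_1 by (intro add_mono mult_left_mono) auto
  also have "\<dots> = 1" using pq by (simp flip: ennreal_plus)
  finally show ?thesis .
qed

lemma nn_integral_Holder_finite:
  assumes [measurable]: "f \<in> borel_measurable M" "g \<in> borel_measurable M"
    and pq: "1 < p" "1 < q" "1 / p + 1 / q = 1" and ab: "0 < a" "0 < b"
    and fa: "(\<integral>\<^sup>+ x. ennpowr (f x) p \<partial>M) = ennreal a"
    and gb: "(\<integral>\<^sup>+ x. ennpowr (g x) q \<partial>M) = ennreal b"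
  shows "(\<integral>\<^sup>+ x. f x * g x \<partial>M) \<le> ennreal (a powr (1 / p) * b powr (1 / q))"
proof -
  define c d where "c = a powr (- 1 / p)" and "d = b powr (- 1 / q)"
  have cd: "0 < c" "0 < d" using ab by (simp_all add: c_def d_def)
  have "(\<integral>\<^sup>+ x. (ennreal c * f x) * (ennreal d * g x) \<partial>M) \<le> 1"
  proof (rule nn_integral_mult_le_1[OF _ _ pq])
    have "c powr p * a = 1" "d powr q * b = 1"
      using ab pq by (simp_all add: c_def d_def powr_powr powr_neg_one)
    then show "(\<integral>\<^sup>+ x. ennpowr (ennreal c * f x) p \<partial>M) \<le> 1"
      "(\<integral>\<^sup>+ x. ennpowr (ennreal d * g x) q \<partial>M) \<le> 1"
      using cd ab fa gb
      by (simp_all add: ennpowr_mult ennpowr_ennreal nn_integral_cmult ennreal_mult'[symmetric])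
  qed measurable
  also have "(\<integral>\<^sup>+ x. (ennreal c * f x) * (ennreal d * g x) \<partial>M) =
      ennreal (c * d) * (\<integral>\<^sup>+ x. f x * g x \<partial>M)"
    using cd by (simp add: ennreal_mult' nn_integral_cmult[symmetric] mult_ac)
  finally have "ennreal (1 / (c * d)) * (ennreal (c * d) * (\<integral>\<^sup>+ x. f x * g x \<partial>M)) \<le>
      ennreal (1 / (c * d)) * 1"
    by (rule mult_left_mono) simp
  moreover have "ennreal (1 / (c * d)) * ennreal (c * d) = 1"
    using cd by (simp add: ennreal_mult'[symmetric])
  moreover have "1 / (c * d) = a powr (1 / p) * b powr (1 / q)"
    using ab by (simp add: c_def d_def powr_minus_divide)
  ultimately show ?thesis by (simp flip: mult.assoc)
qed

lemma nn_integral_Holder: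
  assumes f[measurable]: "f \<in> borel_measurable M" and g[measurable]: "g \<in> borel_measurable M"
    and pq: "1 < p" "1 < q" "1 / p + 1 / q = 1"
  shows "(\<integral>\<^sup>+ x. f x * g x \<partial>M) \<le>
    ennpowr (\<integral>\<^sup>+ x. ennpowr (f x) p \<partial>M) (1 / p) * ennpowr (\<integral>\<^sup>+ x. ennpowr (g x) q \<partial>M) (1 / q)"
    (is "_ \<le> ennpowr ?A _ * ennpowr ?B _")
proof -
  consider (null) "?A = 0 \<or> ?B = 0" | (infinite) "?A \<noteq> 0" "?B \<noteq> 0" "?A = \<infinity> \<or> ?B = \<infinity>"
    | (finite) a b where "0 < a" "0 < b" "?A = ennreal a" "?B = ennreal b"
    by (metis ennreal_cases ennreal_0 infinity_ennreal_def order_le_less)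
  then show ?thesis
  proof cases
    case null
    then have "(AE x in M. f x = 0) \<or> (AE x in M. g x = 0)"
      by (simp add: nn_integral_0_iff_AE ennpowr_eq_0_iff)
    then have "AE x in M. f x * g x = 0" by (auto elim: eventually_mono)
    then have "(\<integral>\<^sup>+ x. f x * g x \<partial>M) = 0" by (simp add: nn_integral_0_iff_AE)
    then show ?thesis by simp
  next
    case infinite
    then have "ennpowr ?A (1 / p) * ennpowr ?B (1 / q) = \<infinity>"
      by (auto simp: ennreal_mult_eq_top_iff ennpowr_eq_0_iff ennpowr_eq_top_iff)
    then show ?thesis by simp
  next
    case finite
    then show ?thesis
      using nn_integral_Holder_finite[OF f g pq] by (simp add: ennpowr_ennreal ennreal_mult')
  qed
qed

lemma measurable_of_Lp_norm_finite: "Lp_norm M p f < \<infinity> \<Longrightarrow> f \<in> borel_measurable M"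
  by (auto simp: Lp_norm_def split: if_splits)

lemma AE_le_of_Lp_norm_top_le: "Lp_norm M \<infinity> f \<le> c \<Longrightarrow> AE x in M. f x \<le> c"
  using esssup_AE[of f M]
  by (auto simp: Lp_norm_def top_unique elim!: eventually_mono split: if_splits)

lemma nn_integral_mult_le_Lp_norm:
  assumes f[measurable]: "f \<in> borel_measurable M" and g[measurable]: "g \<in> borel_measurable M"
    and p: "0 < p" and conj: "1 / r + ennreal (1 / p) = 1"
  shows "(\<integral>\<^sup>+ x. f x * g x \<partial>M) \<le> Lp_norm M r f * ennpowr (\<integral>\<^sup>+ x. ennpowr (g x) p \<partial>M) (1 / p)"
proof (cases r)
  case top
  then have "p = 1" using conj by (simp add: ennreal_eq_1)
  have "(\<integral>\<^sup>+ x. f x * g x \<partial>M) \<le> (\<integral>\<^sup>+ x. Lp_norm M \<infinity> f * g x \<partial>M)"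
    using AE_le_of_Lp_norm_top_le[of M f "Lp_norm M \<infinity> f"]
    by (intro nn_integral_mono_AE) (auto elim!: eventually_mono intro: mult_right_mono)
  then show ?thesis using top \<open>p = 1\<close> by (simp add: nn_integral_cmult ennpowr_1)
next
  case (real \<rho>)
  have "r \<noteq> 0" using conj by auto
  then have "0 < \<rho>" using real by (cases "\<rho> = 0") auto
  then have "1 / r = ennreal (1 / \<rho>)" using real by (simp add: divide_ennreal[symmetric])
  then have "ennreal (1 / \<rho> + 1 / p) = 1" using conj p \<open>0 < \<rho>\<close> by simp
  then have "1 / \<rho> + 1 / p = 1" by (simp only: ennreal_eq_1)
  moreover have "0 < 1 / \<rho>" "0 < 1 / p" using p \<open>0 < \<rho>\<close> by simp_all
  ultimately have "1 / \<rho> < 1" "1 / p < 1" by linarith+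
  then have "1 < \<rho>" "1 < p" using p \<open>0 < \<rho>\<close> by (simp_all add: divide_less_eq)
  then show ?thesis
    using nn_integral_Holder[OF f g _ _ \<open>1 / \<rho> + 1 / p = 1\<close>] real by (simp add: Lp_norm_def)
qed

lemma Lp_norm_change_of_measure:
  assumes M: "sigma_finite_measure M" and Q: "sets Q = sets M" "absolutely_continuous M Q"
    and X: "X \<in> borel_measurable M"
    and q: "0 < q" and s: "0 < s" and conj: "ennreal (q / s) + 1 / r = 1"
  shows "Lp_norm Q (ennreal q) X \<le>
    ennpowr (Lp_norm M r (RN_deriv M Q)) (1 / q) * Lp_norm M (ennreal s) X"
proof -
  have XQ: "X \<in> borel_measurable Q" using X measurable_cong_sets[OF Q(1) refl] by blast
  have "(\<integral>\<^sup>+ x. ennpowr (X x) q \<partial>Q) = (\<integral>\<^sup>+ x. RN_deriv M Q x * ennpowr (X x) q \<partial>M)"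
    using M Q X by (intro sigma_finite_measure.RN_deriv_nn_integral measurable_ennpowr) auto
  also have "\<dots> \<le> Lp_norm M r (RN_deriv M Q) *
      ennpowr (\<integral>\<^sup>+ x. ennpowr (ennpowr (X x) q) (s / q) \<partial>M) (1 / (s / q))"
    using q s conj X by (intro nn_integral_mult_le_Lp_norm) (auto simp: add.commute)
  also have "\<dots> = Lp_norm M r (RN_deriv M Q) * ennpowr (\<integral>\<^sup>+ x. ennpowr (X x) s \<partial>M) (q / s)"
    using q by (simp add: ennpowr_ennpowr)
  finally have "ennpowr (\<integral>\<^sup>+ x. ennpowr (X x) q \<partial>Q) (1 / q) \<le>
      ennpowr (Lp_norm M r (RN_deriv M Q) * ennpowr (\<integral>\<^sup>+ x. ennpowr (X x) s \<partial>M) (q / s)) (1 / q)"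
    using q by (intro ennpowr_mono) auto
  then show ?thesis using X XQ q s by (simp add: Lp_norm_def ennpowr_mult ennpowr_ennpowr)
qed

lemma Lp_norm_leI:
  assumes X: "X \<in> borel_measurable M" and p: "0 < p"
    and moment: "(\<integral>\<^sup>+ x. ennpowr (X x) p \<partial>M) \<le> ennpowr c p"
  shows "Lp_norm M (ennreal p) X \<le> c"
  using ennpowr_mono[OF moment, of "1 / p"] X p
  by (simp add: Lp_norm_def ennpowr_ennpowr ennpowr_1)

lemma (in prob_space) const_le_Lp_norm:
  assumes q: "0 < q" and X: "AE x in M. c \<le> X x"
  shows "c \<le> Lp_norm M (ennreal q) X"
proof (cases "X \<in> borel_measurable M")
  case True
  have "ennpowr c q = (\<integral>\<^sup>+ x. ennpowr c q \<partial>M)" by (simp add: emeasure_space_1)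
  also have "\<dots> \<le> (\<integral>\<^sup>+ x. ennpowr (X x) q \<partial>M)"
    using q X by (intro nn_integral_mono_AE) (auto elim!: eventually_mono intro: ennpowr_mono)
  finally have "ennpowr (ennpowr c q) (1 / q) \<le> ennpowr (\<integral>\<^sup>+ x. ennpowr (X x) q \<partial>M) (1 / q)"
    using q by (intro ennpowr_mono) auto
  then show ?thesis using True q by (simp add: Lp_norm_def ennpowr_ennpowr ennpowr_1)
qed (simp add: Lp_norm_def)


section \<open>Bounds on the compensator\<close>

lemma emeasure_annulus_le_powr:
  fixes m :: "real measure"
  assumes m: "sets m = sets borel" and \<alpha>: "0 < \<alpha>" and A: "0 \<le> A" and d: "0 < d"
    and small: "\<And>r. \<lbrakk>r \<in> \<rat>; 0 < r; r < 1\<rbrakk> \<Longrightarrow>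
      ennreal (r powr \<alpha>) * emeasure m {z. r < \<bar>z\<bar> \<and> \<bar>z\<bar> \<le> 1} \<le> ennreal A"
  shows "emeasure m {z. d < \<bar>z\<bar> \<and> \<bar>z\<bar> \<le> 1} \<le> ennreal (2 powr \<alpha> * A * d powr (-\<alpha>))"
proof (cases "d < 1")
  case False
  then have "{z. d < \<bar>z\<bar> \<and> \<bar>z\<bar> \<le> 1} = {}" by auto
  then show ?thesis by (simp only: emeasure_empty zero_le)
next
  case True
  obtain r where r: "r \<in> \<rat>" "d / 2 < r" "r < d" using Rats_dense_in_real[of "d/2" d] d by auto
  define n where "n = emeasure m {z. r < \<bar>z\<bar> \<and> \<bar>z\<bar> \<le> 1}"
  have "{z. r < \<bar>z\<bar> \<and> \<bar>z\<bar> \<le> 1} \<in> sets m" unfolding m by measurable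
  then have "emeasure m {z. d < \<bar>z\<bar> \<and> \<bar>z\<bar> \<le> 1} \<le> n"
    unfolding n_def using r by (intro emeasure_mono) auto
  also have "n = ennreal (r powr (-\<alpha>)) * (ennreal (r powr \<alpha>) * n)"
    using r d by (simp add: mult.assoc[symmetric] ennreal_mult'[symmetric] powr_add[symmetric])
  also have "\<dots> \<le> ennreal (r powr (-\<alpha>)) * ennreal A"
    using r d True unfolding n_def by (intro mult_left_mono small) auto
  also have "\<dots> = ennreal (A * r powr (-\<alpha>))" using A by (simp add: ennreal_mult mult.commute)
  also have "\<dots> \<le> ennreal (A * (d / 2) powr (-\<alpha>))"
    using r d \<alpha> A by (intro ennreal_leI mult_left_mono powr_mono2') auto
  also have "A * (d / 2) powr (-\<alpha>) = 2 powr \<alpha> * A * d powr (-\<alpha>)"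
    using d by (simp add: powr_divide powr_minus field_simps)
  finally show ?thesis .
qed

lemma emeasure_abs_gt_1_le:
  fixes m :: "real measure"
  assumes m: "sets m = sets borel"
  shows "emeasure m {z. 1 < \<bar>z\<bar>} \<le> (\<integral>\<^sup>+ z. ennreal (z\<^sup>2) \<partial>m)"
proof -
  have "1 \<le> z\<^sup>2" if "1 < \<bar>z\<bar>" for z :: real using one_le_power[of "\<bar>z\<bar>" 2] that by simp
  then have "indicator {z. 1 < \<bar>z\<bar>} z \<le> ennreal (z\<^sup>2)" for z :: real by (simp add: indicator_def)
  then have "(\<integral>\<^sup>+ z. indicator {z. 1 < \<bar>z\<bar>} z \<partial>m) \<le> (\<integral>\<^sup>+ z. ennreal (z\<^sup>2) \<partial>m)"
    by (intro nn_integral_mono)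
  moreover have "{z. 1 < \<bar>z\<bar>} \<in> sets m" unfolding m by measurable
  ultimately show ?thesis by simp
qed

lemma emeasure_tail_le_powr:
  fixes m :: "real measure"
  assumes m: "sets m = sets borel" and \<alpha>: "0 < \<alpha>" and AB: "0 \<le> A" "0 \<le> B"
    and small: "\<And>r. \<lbrakk>r \<in> \<rat>; 0 < r; r < 1\<rbrakk> \<Longrightarrow>
      ennreal (r powr \<alpha>) * emeasure m {z. r < \<bar>z\<bar> \<and> \<bar>z\<bar> \<le> 1} \<le> ennreal A"
    and square: "(\<integral>\<^sup>+ z. ennreal (z\<^sup>2) \<partial>m) \<le> ennreal B"
    and d: "0 < d"
  shows "emeasure m {z. d < \<bar>z\<bar>} \<le> ennreal ((2 powr \<alpha> * A + B) * (d powr (-\<alpha>) + 1))"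
proof -
  have sets: "{z. 1 < \<bar>z\<bar>} \<in> sets m" "{z. d < \<bar>z\<bar> \<and> \<bar>z\<bar> \<le> 1} \<in> sets m"
    unfolding m by measurable
  have "emeasure m {z. d < \<bar>z\<bar>} \<le> emeasure m ({z. d < \<bar>z\<bar> \<and> \<bar>z\<bar> \<le> 1} \<union> {z. 1 < \<bar>z\<bar>})"
    using sets by (intro emeasure_mono sets.Un) auto
  also have "\<dots> \<le> emeasure m {z. d < \<bar>z\<bar> \<and> \<bar>z\<bar> \<le> 1} + emeasure m {z. 1 < \<bar>z\<bar>}"
    using sets by (intro emeasure_subadditive) auto
  also have "\<dots> \<le> ennreal (2 powr \<alpha> * A * d powr (-\<alpha>)) + ennreal B"
    using emeasure_annulus_le_powr[OF m \<alpha> AB(1) d small] emeasure_abs_gt_1_le[OF m] square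
    by (intro add_mono) (auto intro: order_trans)
  also have "\<dots> = ennreal (2 powr \<alpha> * A * d powr (-\<alpha>) + B)" using AB by simp
  also have "\<dots> \<le> ennreal ((2 powr \<alpha> * A + B) * (d powr (-\<alpha>) + 1))"
    using AB by (intro ennreal_leI) (simp add: algebra_simps)
  finally show ?thesis .
qed

lemma space_time_space: "space (time_space T) = {0..T}"
  by (simp add: time_space_def space_restrict_space)

lemma sigma_finite_time_space: "sigma_finite_measure (time_space T)"
  unfolding time_space_def
  by (rule sigma_finite_measure_restrict_space) (simp_all add: sigma_finite_lborel)

lemma AE_time_space_neq: "AE t in time_space T. t \<noteq> a"
  unfolding time_space_def using AE_lborel_singleton[of a] by (subst AE_restrict_space_iff) auto

lemma nn_integral_time_space_const:
  "0 \<le> T \<Longrightarrow> (\<integral>\<^sup>+ t. ennreal c \<partial>time_space T) = ennreal c * ennreal T"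
  unfolding time_space_def by (simp add: emeasure_restrict_space space_restrict_space)

lemma nn_integral_powr_to_end:
  fixes p T :: real
  assumes p: "p < 1" and T: "0 \<le> T"
  shows "(\<integral>\<^sup>+ t. ennreal ((T - t) powr (- p)) \<partial>time_space T) = ennreal (T powr (1 - p) / (1 - p))"
proof -
  have "((\<lambda>x. x powr (- p)) has_integral (T powr (- p + 1) / (- p + 1))) {0..T}"
    using p T by (intro has_integral_powr_from_0) auto
  then have "ennreal (T powr (1 - p) / (1 - p)) =
      (\<integral>\<^sup>+ x. ennreal (indicator {0..T} x * x powr (- p)) \<partial>lborel)"
    by (subst nn_integral_has_integral_lebesgue) (auto simp: add.commute)
  also have "\<dots> = (\<integral>\<^sup>+ t.
      ennreal (indicator {0..T} (T + (-1) * t) * (T + (-1) * t) powr (- p)) \<partial>lborel)"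
    by (subst nn_integral_real_affine[where c="-1" and t=T]) auto
  also have "\<dots> = (\<integral>\<^sup>+ t. ennreal ((T - t) powr (- p)) * indicator {0..T} t \<partial>lborel)"
    by (intro nn_integral_cong) (auto simp: indicator_def)
  also have "\<dots> = (\<integral>\<^sup>+ t. ennreal ((T - t) powr (- p)) \<partial>time_space T)"
    unfolding time_space_def by (subst nn_integral_restrict_space) auto
  finally show ?thesis by simp
qed

definition threshold :: "real \<Rightarrow> real \<Rightarrow> real \<Rightarrow> real \<Rightarrow> real" where
  "threshold T \<epsilon> \<kappa> t = \<epsilon> * npow (T - t) \<kappa>"

lemma threshold_nonneg: "0 < \<epsilon> \<Longrightarrow> 0 \<le> threshold T \<epsilon> \<kappa> t"
  by (simp add: threshold_def npow_def)

lemma threshold_eq_powr: "t < T \<Longrightarrow> threshold T \<epsilon> \<kappa> t = \<epsilon> * (T - t) powr \<kappa>"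
  by (simp add: threshold_def npow_def)

lemma continuous_on_threshold:
  assumes "0 \<le> \<kappa>"
  shows "continuous_on {0..T} (threshold T \<epsilon> \<kappa>)"
proof (cases "\<kappa> = 0")
  case False
  then show ?thesis unfolding threshold_def npow_def using assms
    by (auto intro!: continuous_intros continuous_on_powr')
qed (simp add: threshold_def npow_def)

lemma nn_integral_threshold_powr:
  assumes "0 < \<epsilon>" "0 \<le> T" "\<kappa> * \<alpha> < 1"
  shows "(\<integral>\<^sup>+ t. ennreal (threshold T \<epsilon> \<kappa> t powr (-\<alpha>)) \<partial>time_space T) =
    ennreal (\<epsilon> powr (-\<alpha>) * (T powr (1 - \<kappa> * \<alpha>) / (1 - \<kappa> * \<alpha>)))"
proof -
  have "AE t in time_space T. threshold T \<epsilon> \<kappa> t powr (-\<alpha>) = \<epsilon> powr (-\<alpha>) * (T - t) powr (- (\<kappa> * \<alpha>))"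
    using AE_time_space_neq[of T T] AE_space
  proof eventually_elim
    case (elim t)
    then show ?case
      using assms(1) by (simp add: space_time_space threshold_eq_powr powr_mult powr_powr)
  qed
  then have "(\<integral>\<^sup>+ t. ennreal (threshold T \<epsilon> \<kappa> t powr (-\<alpha>)) \<partial>time_space T) =
      (\<integral>\<^sup>+ t. ennreal (\<epsilon> powr (-\<alpha>)) * ennreal ((T - t) powr (- (\<kappa> * \<alpha>))) \<partial>time_space T)"
    by (intro nn_integral_cong_AE) (auto elim!: eventually_mono simp: ennreal_mult')
  also have "\<dots> = ennreal (\<epsilon> powr (-\<alpha>)) * (\<integral>\<^sup>+ t. ennreal ((T - t) powr (- (\<kappa> * \<alpha>))) \<partial>time_space T)"
    by (rule nn_integral_cmult) (simp add: time_space_def measurable_restrict_space1)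
  also have "\<dots> = ennreal (\<epsilon> powr (-\<alpha>)) * ennreal (T powr (1 - \<kappa> * \<alpha>) / (1 - \<kappa> * \<alpha>))"
    by (simp only: nn_integral_powr_to_end[OF assms(3,2)])
  finally show ?thesis by (simp only: ennreal_mult'[OF powr_ge_zero])
qed

lemma nn_integral_threshold_tail_le:
  assumes C: "0 \<le> C" and \<epsilon>: "0 < \<epsilon>" and T: "0 \<le> T" and \<kappa>: "0 \<le> \<kappa>" "\<kappa> * \<alpha> < 1"
  shows "(\<integral>\<^sup>+ t. ennreal (C * (threshold T \<epsilon> \<kappa> t powr (-\<alpha>) + 1)) \<partial>time_space T) \<le>
    ennreal (C * (T powr (1 - \<kappa> * \<alpha>) / (1 - \<kappa> * \<alpha>) + T) * (\<epsilon> powr (-\<alpha>) + 1))"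
proof -
  define I where "I = T powr (1 - \<kappa> * \<alpha>) / (1 - \<kappa> * \<alpha>)"
  have I: "0 \<le> I" using \<kappa> by (simp add: I_def)
  have "threshold T \<epsilon> \<kappa> \<in> borel_measurable (time_space T)"
    using borel_measurable_continuous_on_restrict[OF continuous_on_threshold[OF \<kappa>(1), of T \<epsilon>]]
    by (simp add: time_space_def
        measurable_cong_sets[OF sets_restrict_space_cong[OF sets_lborel] refl])
  then have "(\<integral>\<^sup>+ t. ennreal (C * (threshold T \<epsilon> \<kappa> t powr (-\<alpha>) + 1)) \<partial>time_space T) =
      ennreal C * (ennreal (\<epsilon> powr (-\<alpha>) * I) + ennreal T)"
    using C \<epsilon> T \<kappa>(2) nn_integral_time_space_const[of T 1]
    by (simp add: ennreal_mult' nn_integral_cmult nn_integral_add nn_integral_threshold_powr I_def)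
  also have "\<dots> = ennreal (C * (\<epsilon> powr (-\<alpha>) * I + T))" using C I T by (simp add: ennreal_mult')
  also have "\<dots> \<le> ennreal (C * (I + T) * (\<epsilon> powr (-\<alpha>) + 1))"
    unfolding mult.assoc using C I T
    by (intro ennreal_leI mult_left_mono) (simp_all add: algebra_simps)
  finally show ?thesis unfolding I_def .
qed

context driving_process
begin

definition small_jump_norm :: "real \<Rightarrow> ennreal" where
  "small_jump_norm \<alpha> = (SUP r\<in>{0<..<1}. Lp_norm (M \<Otimes>\<^sub>M time_space T) \<infinity>
     (\<lambda>(\<omega>, t). ennreal (r powr \<alpha>) * emeasure (\<nu> t \<omega>) {z. r < \<bar>z\<bar> \<and> \<bar>z\<bar> \<le> 1}))"

lemma AE_AE_kernel_tail_le:
  assumes \<alpha>: "0 < \<alpha>" and small_jumps: "small_jump_norm \<alpha> < \<infinity>"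
  obtains C :: real where "0 \<le> C"
    "AE \<omega> in M. AE t in time_space T. \<forall>d>0. emeasure (\<nu> t \<omega>) {z. d < \<bar>z\<bar>} \<le>
        ennreal (C * (d powr (-\<alpha>) + 1))"
proof -
  interpret time: pair_sigma_finite M "time_space T"
    by (intro pair_sigma_finite.intro sigma_finite_measure_axioms sigma_finite_time_space)
  obtain A where A: "small_jump_norm \<alpha> = ennreal A" "0 \<le> A"
    using small_jumps unfolding infinity_ennreal_def less_top_ennreal by blast
  obtain B where B: "0 \<le> B"
    "Lp_norm (M \<Otimes>\<^sub>M time_space T) \<infinity> (\<lambda>(\<omega>, t). \<integral>\<^sup>+ z. ennreal (z\<^sup>2) \<partial>\<nu> t \<omega>) = ennreal B"
    using \<nu>_bounded unfolding infinity_ennreal_def less_top_ennreal by blast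
  have "AE x in M \<Otimes>\<^sub>M time_space T. \<forall>r\<in>{0<..<1} \<inter> \<rat>.
     ennreal (r powr \<alpha>) * emeasure (\<nu> (snd x) (fst x)) {z. r < \<bar>z\<bar> \<and> \<bar>z\<bar> \<le> 1} \<le> ennreal A"
  proof (subst AE_ball_countable, intro countable_Int2 countable_rat, rule ballI)
    fix r :: real assume "r \<in> {0<..<1} \<inter> \<rat>"
    then have "Lp_norm (M \<Otimes>\<^sub>M time_space T) \<infinity>
        (\<lambda>(\<omega>, t). ennreal (r powr \<alpha>) * emeasure (\<nu> t \<omega>) {z. r < \<bar>z\<bar> \<and> \<bar>z\<bar> \<le> 1}) \<le> ennreal A"
      unfolding A(1)[symmetric] small_jump_norm_def by (intro SUP_upper) auto
    from AE_le_of_Lp_norm_top_le[OF this]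
    show "AE x in M \<Otimes>\<^sub>M time_space T.
        ennreal (r powr \<alpha>) * emeasure (\<nu> (snd x) (fst x)) {z. r < \<bar>z\<bar> \<and> \<bar>z\<bar> \<le> 1} \<le> ennreal A"
      by (simp add: case_prod_beta)
  qed
  moreover have "AE x in M \<Otimes>\<^sub>M time_space T. (\<integral>\<^sup>+ z. ennreal (z\<^sup>2) \<partial>\<nu> (snd x) (fst x)) \<le> ennreal B"
    using AE_le_of_Lp_norm_top_le[OF eq_refl[OF B(2)]] by (simp add: case_prod_beta)
  moreover have "AE x in M \<Otimes>\<^sub>M time_space T. sets (\<nu> (snd x) (fst x)) = sets borel"
    using AE_space \<nu>_kernel
    by (auto elim!: eventually_mono simp: space_pair_measure space_time_space levy_kernel_def
        levy_measure_def)
  ultimately have "AE x in M \<Otimes>\<^sub>M time_space T. \<forall>d>0.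
      emeasure (\<nu> (snd x) (fst x)) {z. d < \<bar>z\<bar>} \<le> ennreal ((2 powr \<alpha> * A + B) * (d powr (-\<alpha>) + 1))"
    by eventually_elim (use \<alpha> A(2) B(1) in \<open>auto intro!: emeasure_tail_le_powr\<close>)
  from time.AE_pair[OF this] have "AE \<omega> in M. AE t in time_space T. \<forall>d>0.
      emeasure (\<nu> t \<omega>) {z. d < \<bar>z\<bar>} \<le> ennreal ((2 powr \<alpha> * A + B) * (d powr (-\<alpha>) + 1))"
    by simp
  then show ?thesis using that[of "2 powr \<alpha> * A + B"] A(2) B(1) by simp
qed

lemma compensator_big_marks_le:
  assumes g: "continuous_on {0..T} g" "AE t in time_space T. 0 < g t"
    and tail: "AE \<omega> in M. AE t in time_space T. \<forall>d>0. emeasure (\<nu> t \<omega>) {z. d < \<bar>z\<bar>} \<le> ennreal (f d)"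
  shows "AE \<omega> in M. emeasure (\<pi>Z \<omega>) (big_marks T g) \<le> (\<integral>\<^sup>+ t. ennreal (f (g t)) \<partial>time_space T)"
  using tail AE_space
proof eventually_elim
  case (elim \<omega>)
  have "emeasure (\<pi>Z \<omega>) (big_marks T g) =
      (\<integral>\<^sup>+ t. emeasure (\<nu> t \<omega>) {z. (t, z) \<in> big_marks T g} \<partial>time_space T)"
    by (rule \<pi>Z_density[OF elim(2) sets_big_marks[OF g(1)]])
  also have "\<dots> \<le> (\<integral>\<^sup>+ t. ennreal (f (g t)) \<partial>time_space T)"
  proof (rule nn_integral_mono_AE, use elim(1) g(2) AE_space in eventually_elim)
    case (elim t)
    then have "{z. (t, z) \<in> big_marks T g} = {z. g t < \<bar>z\<bar>}"
      by (auto simp: big_marks_def space_time_space)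
    then show ?case using elim by simp
  qed
  finally show ?case .
qed

lemma compensator_threshold_le:
  assumes \<alpha>: "0 < \<alpha>" and \<kappa>: "0 \<le> \<kappa>" "\<kappa> * \<alpha> < 1" and small_jumps: "small_jump_norm \<alpha> < \<infinity>"
  obtains K :: real where "0 \<le> K"
    "\<And>\<epsilon>. 0 < \<epsilon> \<Longrightarrow> AE \<omega> in M. emeasure (\<pi>Z \<omega>) (big_marks T (threshold T \<epsilon> \<kappa>)) \<le>
        ennreal (K * (\<epsilon> powr (-\<alpha>) + 1))"
proof -
  obtain C where C: "0 \<le> C"
    "AE \<omega> in M. AE t in time_space T. \<forall>d>0. emeasure (\<nu> t \<omega>) {z. d < \<bar>z\<bar>} \<le>
        ennreal (C * (d powr (-\<alpha>) + 1))"
    by (rule AE_AE_kernel_tail_le[OF \<alpha> small_jumps])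
  define K where "K = C * (T powr (1 - \<kappa> * \<alpha>) / (1 - \<kappa> * \<alpha>) + T)"
  show ?thesis
  proof (rule that[of K])
    show "0 \<le> K" using C(1) \<kappa> T_pos by (simp add: K_def)
    fix \<epsilon> :: real assume \<epsilon>: "0 < \<epsilon>"
    have "AE t in time_space T. 0 < threshold T \<epsilon> \<kappa> t"
      using AE_time_space_neq[of T T] AE_space
      by eventually_elim (use \<epsilon> in \<open>simp add: space_time_space threshold_eq_powr\<close>)
    from compensator_big_marks_le[OF continuous_on_threshold[OF \<kappa>(1)] this C(2)]
    have "AE \<omega> in M. emeasure (\<pi>Z \<omega>) (big_marks T (threshold T \<epsilon> \<kappa>)) \<le>
        (\<integral>\<^sup>+ t. ennreal (C * (threshold T \<epsilon> \<kappa> t powr (-\<alpha>) + 1)) \<partial>time_space T)" .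
    moreover have "(\<integral>\<^sup>+ t. ennreal (C * (threshold T \<epsilon> \<kappa> t powr (-\<alpha>) + 1)) \<partial>time_space T) \<le>
        ennreal (K * (\<epsilon> powr (-\<alpha>) + 1))"
      unfolding K_def using C(1) \<epsilon> \<kappa> T_pos by (intro nn_integral_threshold_tail_le) auto
    ultimately show "AE \<omega> in M. emeasure (\<pi>Z \<omega>) (big_marks T (threshold T \<epsilon> \<kappa>)) \<le>
        ennreal (K * (\<epsilon> powr (-\<alpha>) + 1))"
      by (auto elim!: eventually_mono intro: order_trans)
  qed
qed

end


section \<open>Knots of the combined net\<close>

lemma successive_minima_hit:
  fixes \<rho> :: "nat \<Rightarrow> 'a::linorder"
  assumes J: "finite J" "J \<subseteq> {\<rho> 0<..}"
    and step: "\<And>i. J \<inter> {\<rho> i<..} \<noteq> {} \<Longrightarrow> \<rho> (Suc i) = Min (J \<inter> {\<rho> i<..})"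
    and t: "t \<in> J"
  shows "t \<in> range \<rho>"
  using t
proof (induction "card {u\<in>J. u < t}" arbitrary: t rule: less_induct)
  case (less t)
  define p where "p = Max (insert (\<rho> 0) {u\<in>J. u < t})"
  have "p \<in> insert (\<rho> 0) {u\<in>J. u < t}" unfolding p_def using J(1) by (intro Max_in) auto
  then have p: "p = \<rho> 0 \<or> p \<in> J" "p < t" using J(2) less.prems by auto
  have "p \<in> range \<rho>"
  proof (cases "p \<in> J")
    case True
    have "{u\<in>J. u < p} \<subset> {u\<in>J. u < t}" using True p(2) by auto
    then show ?thesis using True J(1) by (intro less.hyps psubset_card_mono) auto
  qed (use p(1) in blast)
  then obtain i where i: "\<rho> i = p" by blast
  have "t \<le> u" if "u \<in> J" "p < u" for u
  proof (rule ccontr)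
    assume "\<not> t \<le> u"
    then have "u \<le> p" unfolding p_def using J(1) that by (intro Max_ge) auto
    then show False using that by simp
  qed
  then have "Min (J \<inter> {p<..}) = t" using less.prems p(2) J(1) by (intro Min_eqI) auto
  then have "\<rho> (Suc i) = t" using step[of i] less.prems p(2) i by auto
  then show ?case by blast
qed

lemma range_successive_minima:
  fixes \<rho> :: "nat \<Rightarrow> 'a::linorder"
  assumes J: "finite J" "J \<subseteq> {\<rho> 0<..}"
    and step: "\<And>i. \<rho> (Suc i) = (if J \<inter> {\<rho> i<..} = {} then b else Min (J \<inter> {\<rho> i<..}))"
  shows "range \<rho> = {\<rho> 0} \<union> J \<union> {b}"
proof (intro antisym subsetI)
  have "\<rho> i \<in> {\<rho> 0} \<union> J \<union> {b}" for i
  proof (cases i)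
    case (Suc k)
    have "Min (J \<inter> {\<rho> k<..}) \<in> J" if "J \<inter> {\<rho> k<..} \<noteq> {}"
      using Min_in[OF _ that] J(1) by simp
    then show ?thesis using step[of k] Suc by auto
  qed simp
  then show "x \<in> {\<rho> 0} \<union> J \<union> {b}" if "x \<in> range \<rho>" for x using that by blast
next
  have hit: "t \<in> range \<rho>" if "t \<in> J" for t
    using J step that by (intro successive_minima_hit[of J]) simp_all
  then have "Max (insert (\<rho> 0) J) \<in> range \<rho>"
    using Max_in[of "insert (\<rho> 0) J"] J(1) by auto
  then obtain i where i: "\<rho> i = Max (insert (\<rho> 0) J)" by (metis imageE)
  have "u \<le> \<rho> i" if "u \<in> J" for u unfolding i using J(1) that by simp
  then have "J \<inter> {\<rho> i<..} = {}" using leD by blast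
  then have "\<rho> (Suc i) = b" using step[of i] by simp
  then show "x \<in> range \<rho>" if "x \<in> {\<rho> 0} \<union> J \<union> {b}" for x using that hit by blast
qed

lemma range_rho:
  assumes T: "0 < T"
    and J: "finite (jump_times T S (\<lambda>t. \<sigma> (left_limit S t \<omega>) * \<epsilon> * npow (T - t) \<kappa>) \<omega>)"
      (is "finite ?J")
  shows "range (\<lambda>i. rho T \<sigma> S \<epsilon> \<kappa> i \<omega>) = {0} \<union> ?J \<union> {T}"
proof -
  define \<rho> where "\<rho> i = rho T \<sigma> S \<epsilon> \<kappa> i \<omega>" for i
  have step: "\<rho> (Suc i) = (if ?J \<inter> {\<rho> i<..} = {} then T else Min (?J \<inter> {\<rho> i<..}))"
    if "0 \<le> \<rho> i" for i
  proof -
    have "{t \<in> {\<rho> i<..T}. \<bar>jump S t \<omega>\<bar> > \<sigma> (left_limit S t \<omega>) * \<epsilon> * npow (T - t) \<kappa>} = ?J \<inter> {\<rho> i<..}"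
      using that by (auto simp: jump_times_def)
    then have "\<rho> (Suc i) = (if ?J \<inter> {\<rho> i<..} = {} then T else min (Inf (?J \<inter> {\<rho> i<..})) T)"
      by (simp add: \<rho>_def Let_def)
    moreover have "min (Inf (?J \<inter> {\<rho> i<..})) T = Min (?J \<inter> {\<rho> i<..})" if "?J \<inter> {\<rho> i<..} \<noteq> {}"
    proof -
      have "Min (?J \<inter> {\<rho> i<..}) \<in> ?J" using Min_in[OF _ that] J by simp
      then have "Min (?J \<inter> {\<rho> i<..}) \<le> T" by (simp add: jump_times_def)
      then show ?thesis using that J by (simp add: cInf_eq_Min min_absorb1)
    qed
    ultimately show ?thesis by simp
  qed
  have "0 \<le> \<rho> i" for i
  proof (induction i)
    case (Suc i)
    have "0 \<le> Min (?J \<inter> {\<rho> i<..})" if "?J \<inter> {\<rho> i<..} \<noteq> {}"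
      using Min_in[OF _ that] J Suc by simp
    then show ?case using step[OF Suc] T by simp
  qed (simp add: \<rho>_def)
  then have "range \<rho> = {\<rho> 0} \<union> ?J \<union> {T}"
    using J step by (intro range_successive_minima) (auto simp: \<rho>_def jump_times_def)
  then show ?thesis unfolding \<rho>_def by simp
qed

lemma T_det_endpoints:
  assumes "\<tau> \<in> T_det T"
  shows "0 \<in> set \<tau>" "T \<in> set \<tau>"
proof -
  have "\<tau> \<noteq> []" using assms by (auto simp: T_det_def)
  then show "0 \<in> set \<tau>" "T \<in> set \<tau>"
    using assms hd_in_set[of \<tau>] last_in_set[of \<tau>] by (auto simp: T_det_def)
qed

lemma ecard_T_det: "\<tau> \<in> T_det T \<Longrightarrow> ecard (set \<tau>) = of_nat (length \<tau>)"
  by (simp add: T_det_def strict_sorted_iff distinct_card)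

lemma length_le_Lp_norm_num_knots:
  assumes "prob_space Q" "0 < q" "\<tau> \<in> T_det T"
  shows "of_nat (length \<tau>) \<le> Lp_norm Q (ennreal q) (\<lambda>\<omega>. num_knots (combined_net T \<sigma> S \<tau> \<epsilon> \<kappa> \<omega>))"
proof (rule prob_space.const_le_Lp_norm[OF assms(1,2) AE_I2])
  fix \<omega>
  have "ecard (set \<tau>) \<le> num_knots (combined_net T \<sigma> S \<tau> \<epsilon> \<kappa> \<omega>)"
    unfolding num_knots_def combined_net_def by (rule emeasure_mono) auto
  then show "of_nat (length \<tau>) \<le> num_knots (combined_net T \<sigma> S \<tau> \<epsilon> \<kappa> \<omega>)"
    by (simp only: ecard_T_det[OF assms(3)])
qed

lemma (in complete_measure) measurable_AE_eq:
  assumes f: "f \<in> M \<rightarrow>\<^sub>M N" and AE_eq: "AE x in M. f x = g x" and g: "g \<in> space M \<rightarrow> space N"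
  shows "g \<in> M \<rightarrow>\<^sub>M N"
proof (rule measurableI)
  show "g x \<in> space N" if "x \<in> space M" for x using g that by auto
  fix A assume A: "A \<in> sets N"
  show "g -` A \<inter> space M \<in> sets M"
  proof (rule in_sets_AE)
    show "AE x in M. x \<in> f -` A \<inter> space M \<longleftrightarrow> x \<in> g -` A \<inter> space M"
      using AE_eq by eventually_elim auto
    show "f -` A \<inter> space M \<in> sets M" using f A by (rule measurable_sets)
  qed auto
qed

lemma powr_uminus_le_linear:
  fixes \<epsilon> :: "nat \<Rightarrow> real"
  assumes \<alpha>: "0 < \<alpha>" and \<epsilon>: "\<And>n. 1 \<le> n \<Longrightarrow> 0 < \<epsilon> n"
    and INF: "0 < (INF n\<in>{1..}. real n powr (1 / \<alpha>) * \<epsilon> n)"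
  obtains C where "0 \<le> C" "\<And>n. 1 \<le> n \<Longrightarrow> \<epsilon> n powr (-\<alpha>) \<le> C * real n"
proof -
  define c where "c = (INF n\<in>{1..}. real n powr (1 / \<alpha>) * \<epsilon> n)"
  have "\<epsilon> n powr (-\<alpha>) \<le> c powr (-\<alpha>) * real n" if n: "1 \<le> n" for n
  proof -
    have "c \<le> real n powr (1 / \<alpha>) * \<epsilon> n"
      unfolding c_def using n \<epsilon> by (intro cINF_lower bdd_belowI2[of _ 0]) (auto simp: less_imp_le)
    then have "(real n powr (1 / \<alpha>) * \<epsilon> n) powr (-\<alpha>) \<le> c powr (-\<alpha>)"
      using INF \<alpha> unfolding c_def[symmetric] by (intro powr_mono2') auto
    moreover have "(real n powr (1 / \<alpha>) * \<epsilon> n) powr (-\<alpha>) = \<epsilon> n powr (-\<alpha>) / n"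
      using \<alpha> \<epsilon>[OF n] n by (simp add: powr_mult powr_powr powr_minus_divide)
    ultimately show ?thesis using n by (simp add: divide_le_eq)
  qed
  then show ?thesis using that[of "c powr (-\<alpha>)"] by simp
qed

context price_process
begin

lemma Z_CL: "Z \<in> CL M F T"
  using Z_semimartingale by (simp add: semimartingale_def)

lemma jump_S: "AE \<omega> in M. \<forall>t\<in>{0<..T}. jump S t \<omega> = \<sigma> (left_limit S t \<omega>) * jump Z t \<omega>"
proof -
  obtain I where I: "stochastic_integral M F T (\<lambda>t \<omega>. \<sigma> (left_limit S t \<omega>)) Z I"
    "AE \<omega> in M. \<forall>t\<in>{0..T}. S t \<omega> = s0 + I t \<omega>"
    using S_solution by blast
  have I_CL: "I \<in> CL M F T" using I(1) by (simp add: stochastic_integral_def)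
  from jump_stochastic_integral[OF I(1)] I(2) AE_space show ?thesis
  proof (eventually_elim, intro ballI)
    case (elim \<omega>)
    fix t assume t: "t \<in> {0<..T}"
    have "((\<lambda>s. s0 + I s \<omega>) \<longlongrightarrow> s0 + (I t \<omega> - jump I t \<omega>)) (at_left t)"
      using I_CL elim(3) t
      by (intro tendsto_intros cadlag_path_tendsto_at_left[where T=T] CL_cadlag_path)
    moreover have "\<forall>\<^sub>F s in at_left t. s0 + I s \<omega> = S s \<omega>"
      using eventually_at_left_real[of 0 t] t elim(2) by (auto elim!: eventually_mono)
    ultimately have "((\<lambda>s. S s \<omega>) \<longlongrightarrow> s0 + (I t \<omega> - jump I t \<omega>)) (at_left t)"
      by (rule Lim_transform_eventually)
    then have "jump S t \<omega> = jump I t \<omega>"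
      using jump_eqI[where X=S and \<omega>=\<omega> and t=t] elim(2) t by simp
    then show "jump S t \<omega> = \<sigma> (left_limit S t \<omega>) * jump Z t \<omega>" using elim(1) t by simp
  qed
qed

lemma combined_net_eq:
  assumes \<tau>: "\<tau> \<in> T_det T" and fin: "AE \<omega> in M. finite (jump_times T Z (threshold T \<epsilon> \<kappa>) \<omega>)"
  shows "AE \<omega> in M. combined_net T \<sigma> S \<tau> \<epsilon> \<kappa> \<omega> = set \<tau> \<union> jump_times T Z (threshold T \<epsilon> \<kappa>) \<omega>"
  using fin jump_S AE_space
proof eventually_elim
  case (elim \<omega>)
  have jumps_eq: "jump_times T S (\<lambda>t. \<sigma> (left_limit S t \<omega>) * \<epsilon> * npow (T - t) \<kappa>) \<omega> =
     jump_times T Z (threshold T \<epsilon> \<kappa>) \<omega>"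
    unfolding jump_times_def
  proof (intro Collect_cong conj_cong refl)
    fix t assume t: "t \<in> {0<..T}"
    then have "0 < \<sigma> (left_limit S t \<omega>)" using S_mem[OF elim(3), of t] \<sigma>_pos by auto
    then show "\<sigma> (left_limit S t \<omega>) * \<epsilon> * npow (T - t) \<kappa> < \<bar>jump S t \<omega>\<bar> \<longleftrightarrow>
        threshold T \<epsilon> \<kappa> t < \<bar>jump Z t \<omega>\<bar>"
      using elim(2) t by (simp add: threshold_def abs_mult mult.assoc)
  qed
  have "range (\<lambda>i. rho T \<sigma> S \<epsilon> \<kappa> i \<omega>) = {0} \<union> jump_times T Z (threshold T \<epsilon> \<kappa>) \<omega> \<union> {T}"
    unfolding jumps_eq[symmetric] using elim(1) T_pos by (intro range_rho) (simp_all only: jumps_eq)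
  then show ?case using T_det_endpoints[OF \<tau>] unfolding combined_net_def by auto
qed

lemma Lp_norm_2_num_knots_le:
  assumes \<tau>: "\<tau> \<in> T_det T" and \<epsilon>: "0 < \<epsilon>" and \<kappa>: "0 \<le> \<kappa>" and L: "0 \<le> L"
    and bound: "AE \<omega> in M. emeasure (\<pi>Z \<omega>) (big_marks T (threshold T \<epsilon> \<kappa>)) \<le> ennreal L"
  shows "Lp_norm M 2 (\<lambda>\<omega>. num_knots (combined_net T \<sigma> S \<tau> \<epsilon> \<kappa> \<omega>)) \<le>
      ennreal (2 * (real (length \<tau>) + L))"
    (is "Lp_norm M 2 ?N \<le> _")
proof -
  let ?K = "\<lambda>\<omega>. ecard (set \<tau> \<union> jump_times T Z (threshold T \<epsilon> \<kappa>) \<omega>)"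
  note g = continuous_on_threshold[OF \<kappa>, of T \<epsilon>] threshold_nonneg[OF \<epsilon>, of T \<kappa>]
  have "AE \<omega> in M. finite (jump_times T Z (threshold T \<epsilon> \<kappa>) \<omega>)"
    using AE_finite_jump_times[OF Z_CL \<pi>Z_compensator g bound] by simp
  from combined_net_eq[OF \<tau> this] have num_knots_eq: "AE \<omega> in M. ?K \<omega> = ?N \<omega>"
    by eventually_elim (simp add: num_knots_def)
  have "?N \<in> borel_measurable M"
    using measurable_ecard_Un_jump_times[OF Z_CL g(1)] num_knots_eq by (rule measurable_AE_eq) simp
  define l where "l = real (length \<tau>)"
  have "(\<integral>\<^sup>+ \<omega>. (?N \<omega>)\<^sup>2 \<partial>M) = (\<integral>\<^sup>+ \<omega>. (?K \<omega>)\<^sup>2 \<partial>M)"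
    using num_knots_eq by (intro nn_integral_cong_AE) (auto elim: eventually_mono)
  also have "\<dots> \<le> 2 * ((ecard (set \<tau>))\<^sup>2 + (2 * ennreal L + 1) * ennreal L)"
    by (rule ecard_Un_jump_times_second_moment[OF Z_CL \<pi>Z_compensator g bound])
  also have "ecard (set \<tau>) = ennreal l"
    unfolding l_def ecard_T_det[OF \<tau>] by (rule ennreal_of_nat_eq_real_of_nat)
  also have "2 * ((ennreal l)\<^sup>2 + (2 * ennreal L + 1) * ennreal L) =
      ennreal (2 * (l\<^sup>2 + (2 * L + 1) * L))"
    using L by (simp add: ennreal_mult' ennreal_power l_def)
  also have "\<dots> \<le> ennreal ((2 * (l + L))\<^sup>2)"
  proof (rule ennreal_leI)
    have "1 * L \<le> l * L" using \<tau> L by (intro mult_right_mono) (auto simp: l_def T_det_def)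
    then have "0 \<le> 2 * l\<^sup>2 + 6 * (l * L) + 2 * (l * L - L)"
      using L by (intro add_nonneg_nonneg) (simp_all add: l_def)
    then have "2 * (l\<^sup>2 + (2 * L + 1) * L) \<le>
        2 * (l\<^sup>2 + (2 * L + 1) * L) + (2 * l\<^sup>2 + 6 * (l * L) + 2 * (l * L - L))" by simp
    also have "\<dots> = (2 * (l + L))\<^sup>2" by (simp add: power2_eq_square algebra_simps)
    finally show "2 * (l\<^sup>2 + (2 * L + 1) * L) \<le> (2 * (l + L))\<^sup>2" .
  qed
  also have "\<dots> = ennpowr (ennreal (2 * (l + L))) 2"
    unfolding ennpowr_2 using L by (intro ennreal_power[symmetric]) (simp add: l_def)
  finally show ?thesis
    using Lp_norm_leI[OF \<open>?N \<in> borel_measurable M\<close>, of 2 "ennreal (2 * (l + L))"]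
    by (simp add: ennpowr_2 l_def)
qed

lemma Lp_norm_2_num_knots_le_linear:
  fixes \<epsilon> :: "nat \<Rightarrow> real"
  assumes \<alpha>: "0 < \<alpha>" and \<kappa>: "0 \<le> \<kappa>" "\<kappa> * \<alpha> < 1" and small_jumps: "small_jump_norm \<alpha> < \<infinity>"
    and \<epsilon>: "\<And>n. 1 \<le> n \<Longrightarrow> 0 < \<epsilon> n" "0 < (INF n\<in>{1..}. real n powr (1 / \<alpha>) * \<epsilon> n)"
  obtains C where "0 \<le> C" "\<And>n \<tau>. \<lbrakk>1 \<le> n; \<tau> \<in> T_det T; length \<tau> = n + 1\<rbrakk> \<Longrightarrow>
    Lp_norm M 2 (\<lambda>\<omega>. num_knots (combined_net T \<sigma> S \<tau> (\<epsilon> n) \<kappa> \<omega>)) \<le> ennreal (C * real n)"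
proof -
  obtain K where K: "0 \<le> K" "\<And>\<epsilon>. 0 < \<epsilon> \<Longrightarrow>
      AE \<omega> in M. emeasure (\<pi>Z \<omega>) (big_marks T (threshold T \<epsilon> \<kappa>)) \<le> ennreal (K * (\<epsilon> powr (-\<alpha>) + 1))"
    using compensator_threshold_le[OF \<alpha> \<kappa> small_jumps] by blast
  obtain A where A: "0 \<le> A" "\<And>n. 1 \<le> n \<Longrightarrow> \<epsilon> n powr (-\<alpha>) \<le> A * real n"
    using powr_uminus_le_linear[OF \<alpha> \<epsilon>] by blast
  show ?thesis
  proof (rule that[of "2 * (2 + K * (A + 1))"])
    fix n :: nat and \<tau> assume n: "1 \<le> n" and \<tau>: "\<tau> \<in> T_det T" "length \<tau> = n + 1"
    have "\<epsilon> n powr (-\<alpha>) + 1 \<le> (A + 1) * real n" using A(2)[OF n] n by (simp add: algebra_simps)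
    then have "K * (\<epsilon> n powr (-\<alpha>) + 1) \<le> K * (A + 1) * real n"
      using K(1) by (simp add: mult.assoc mult_left_mono)
    then have "2 * (real (length \<tau>) + K * (\<epsilon> n powr (-\<alpha>) + 1)) \<le> 2 * (2 + K * (A + 1)) * real n"
      using n \<tau>(2) by (simp add: algebra_simps)
    moreover have "Lp_norm M 2 (\<lambda>\<omega>. num_knots (combined_net T \<sigma> S \<tau> (\<epsilon> n) \<kappa> \<omega>)) \<le>
        ennreal (2 * (real (length \<tau>) + K * (\<epsilon> n powr (-\<alpha>) + 1)))"
      using K \<epsilon>(1)[OF n] by (intro Lp_norm_2_num_knots_le \<tau>(1) \<kappa>(1)) auto
    ultimately show "Lp_norm M 2 (\<lambda>\<omega>. num_knots (combined_net T \<sigma> S \<tau> (\<epsilon> n) \<kappa> \<omega>)) \<le>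
        ennreal (2 * (2 + K * (A + 1)) * real n)"
      by (meson ennreal_leI order_trans)
  qed (use K A in simp)
qed

lemma Lp_norm_num_knots_le_linear:
  fixes \<epsilon> :: "nat \<Rightarrow> real" and r :: ennreal
  assumes Q: "sets Q = sets M" "absolutely_continuous M Q"
    and density: "Lp_norm M r (RN_deriv M Q) < \<infinity>"
    and q: "0 < q" and qr: "ennreal (q / 2) + 1 / r = 1"
    and \<alpha>: "0 < \<alpha>" and \<kappa>: "0 \<le> \<kappa>" "\<kappa> * \<alpha> < 1" and small_jumps: "small_jump_norm \<alpha> < \<infinity>"
    and \<epsilon>: "\<And>n. 1 \<le> n \<Longrightarrow> 0 < \<epsilon> n" "0 < (INF n\<in>{1..}. real n powr (1 / \<alpha>) * \<epsilon> n)"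
  obtains C where "\<And>n \<tau>. \<lbrakk>1 \<le> n; \<tau> \<in> T_det T; length \<tau> = n + 1\<rbrakk> \<Longrightarrow>
    Lp_norm Q (ennreal q) (\<lambda>\<omega>. num_knots (combined_net T \<sigma> S \<tau> (\<epsilon> n) \<kappa> \<omega>)) \<le> ennreal (C * real n)"
proof -
  define N where "N n \<tau> \<omega> = num_knots (combined_net T \<sigma> S \<tau> (\<epsilon> n) \<kappa> \<omega>)" for n \<tau> \<omega>
  obtain C where C: "0 \<le> C" "\<And>n \<tau>. \<lbrakk>1 \<le> n; \<tau> \<in> T_det T; length \<tau> = n + 1\<rbrakk> \<Longrightarrow>
      Lp_norm M 2 (N n \<tau>) \<le> ennreal (C * real n)"
    using Lp_norm_2_num_knots_le_linear[OF \<alpha> \<kappa> small_jumps \<epsilon>] unfolding N_def by blast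
  obtain d where d: "0 \<le> d" "ennpowr (Lp_norm M r (RN_deriv M Q)) (1 / q) = ennreal d"
    using density by (metis ennpowr_eq_top_iff ennreal_cases infinity_ennreal_def less_irrefl)
  show ?thesis
  proof (rule that[of "d * C", folded N_def])
    fix n :: nat and \<tau> assume n: "1 \<le> n" "\<tau> \<in> T_det T" "length \<tau> = n + 1"
    have "N n \<tau> \<in> borel_measurable M"
      using C(2)[OF n] by (intro measurable_of_Lp_norm_finite[of M 2]) (auto intro: le_less_trans)
    then have "Lp_norm Q (ennreal q) (N n \<tau>) \<le> ennreal d * Lp_norm M 2 (N n \<tau>)"
      using Lp_norm_change_of_measure[OF sigma_finite_measure_axioms Q, of _ q 2 r] q qr d by simp
    also have "\<dots> \<le> ennreal d * ennreal (C * real n)" using C(2)[OF n] by (rule mult_left_mono) simp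
    also have "\<dots> = ennreal (d * C * real n)" using d(1) by (simp add: ennreal_mult' mult.assoc)
    finally show "Lp_norm Q (ennreal q) (N n \<tau>) \<le> ennreal (d * C * real n)" .
  qed
qed

end

theorem proposition3p16:
  fixes M Q :: "'a measure" and F :: "real \<Rightarrow> 'a measure" and T z0 s0 :: real
    and Z Zc aZ bZ S :: "'a process"
    and \<pi>Z :: "'a \<Rightarrow> (real \<times> real) measure" and \<nu> :: "real \<Rightarrow> 'a \<Rightarrow> real measure"
    and R\<^sub>S :: "real set" and \<sigma> :: "real \<Rightarrow> real"
    and q \<alpha> :: real and r :: ennreal
  assumes setting: "price_process M F T Z z0 Zc \<pi>Z \<nu> aZ bZ S s0 R\<^sub>S \<sigma>"
    and q: "1 \<le> q" "q \<le> 2" and r: "2 \<le> r" and qr: "ennreal (q / 2) + 1 / r = 1"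
    and Q: "prob_space Q" "sets Q = sets M" "absolutely_continuous M Q"
    and density: "Lp_norm M r (RN_deriv M Q) < \<infinity>"
    and \<alpha>: "0 < \<alpha>" "\<alpha> \<le> 2"
    and small_jumps:
      "(SUP r'\<in>{0<..<1}. Lp_norm (M \<Otimes>\<^sub>M time_space T) \<infinity>
          (\<lambda>(\<omega>, t). ennreal (r' powr \<alpha>) * emeasure (\<nu> t \<omega>) {z. r' < \<bar>z\<bar> \<and> \<bar>z\<bar> \<le> 1})) < \<infinity>"
  shows "\<forall>\<theta>\<in>{0<..1}. \<forall>\<epsilon> :: nat \<Rightarrow> real.
           (\<forall>n\<ge>1. 0 < \<epsilon> n) \<and> 0 < (INF n\<in>{1..}. real n powr (1 / \<alpha>) * \<epsilon> n) \<longrightarrow>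
           (\<exists>c :: real. 1 \<le> c \<and>
              (\<forall>n\<ge>1. \<forall>\<tau>\<in>T_det T. length \<tau> = n + 1 \<longrightarrow>
                 ennreal (real n / c)
                   \<le> Lp_norm Q (ennreal q) (\<lambda>\<omega>. num_knots (combined_net T \<sigma> S \<tau> (\<epsilon> n) ((1 - \<theta>) / 2) \<omega>)) \<and>
                 Lp_norm Q (ennreal q) (\<lambda>\<omega>. num_knots (combined_net T \<sigma> S \<tau> (\<epsilon> n) ((1 - \<theta>) / 2) \<omega>))
                   \<le> ennreal (c * real n)))"
proof (intro ballI allI impI, goal_cases bounds)
  case (bounds \<theta> \<epsilon>)
  interpret price_process M F T Z z0 Zc \<pi>Z \<nu> aZ bZ S s0 R\<^sub>S \<sigma> by (rule setting)
  define \<kappa> where "\<kappa> = (1 - \<theta>) / 2"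
  have "\<kappa> * \<alpha> \<le> \<kappa> * 2" using bounds(1) \<alpha> by (intro mult_left_mono) (auto simp: \<kappa>_def)
  then have \<kappa>: "0 \<le> \<kappa>" "\<kappa> * \<alpha> < 1" using bounds(1) by (auto simp: \<kappa>_def)
  have "0 < q" using q by simp
  define norm_knots where "norm_knots n \<tau> =
    Lp_norm Q (ennreal q) (\<lambda>\<omega>. num_knots (combined_net T \<sigma> S \<tau> (\<epsilon> n) \<kappa> \<omega>))" for n \<tau>
  obtain C where C: "\<And>n \<tau>. \<lbrakk>1 \<le> n; \<tau> \<in> T_det T; length \<tau> = n + 1\<rbrakk> \<Longrightarrow>
      norm_knots n \<tau> \<le> ennreal (C * real n)"
    using Lp_norm_num_knots_le_linear[OF Q(2,3) density \<open>0 < q\<close> qr \<alpha>(1) \<kappa>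
        small_jumps[folded small_jump_norm_def], of \<epsilon>] bounds(2)
    unfolding norm_knots_def by blast
  define c where "c = max 1 C"
  have "ennreal (real n / c) \<le> norm_knots n \<tau> \<and> norm_knots n \<tau> \<le> ennreal (c * real n)"
    if n: "1 \<le> n" and \<tau>: "\<tau> \<in> T_det T" "length \<tau> = n + 1" for n \<tau>
  proof
    have "real n / c \<le> real n / 1" by (intro divide_left_mono) (auto simp: c_def)
    then have "ennreal (real n / c) \<le> of_nat (length \<tau>)"
      unfolding \<tau>(2) ennreal_of_nat_eq_real_of_nat by (intro ennreal_leI) simp
    also have "\<dots> \<le> norm_knots n \<tau>"
      unfolding norm_knots_def by (rule length_le_Lp_norm_num_knots[OF Q(1) \<open>0 < q\<close> \<tau>(1)])
    finally show "ennreal (real n / c) \<le> norm_knots n \<tau>" .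
    show "norm_knots n \<tau> \<le> ennreal (c * real n)"
      by (rule order_trans[OF C[OF n \<tau>]]) (auto simp: c_def intro!: ennreal_leI mult_right_mono)
  qed
  then show ?case
    unfolding norm_knots_def \<kappa>_def by (intro exI[of _ c]) (simp add: c_def)
qed

end
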